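(* Let $X$ be a Banach lattice and let $T\in\mathcal{L}(X)$ be a positive operator (i.e., $Tf\ge0$ for all $f\ge0$) which is strongly Kreiss bounded with constant $K_s$. (1) If $X$ is $p$-convex with $p\in(2,\infty]$, then there exist constants $C,\beta\ge0$ depending on $X$ and $K_s$ (not otherwise on $T$) such that $$\|T^n\|\le C\,n^{\frac1p}(\log(n+2))^{\beta},\qquad n\ge1.$$ (2) If $X$ is $q$-concave with $q\in[1,2)$, then there exist constants $C,\beta\ge0$ depending on $X$ and $K_s$ (not otherwise on $T$) such that $$\|T^n\|\le C\,n^{\frac1{q'}}(\log(n+2))^{\beta},\qquad n\ge1,$$ where $\frac1q+\frac1{q'}=1$.
   Context: Banach spaces (and lattices) are over $\mathbb{C}$; $\mathcal{L}(X)$ is the space of bounded linear operators on $X$; $1/\infty=0$. An operator $T\in\mathcal{L}(X)$ is strongly Kreiss bounded with constant $K_s$ if every $\lambda\in\mathbb{C}$ with $|\lambda|>1$ is in the resolvent set of $T$ and $\|(\lambda-T)^{-n}\|\le K_s(|\lambda|-1)^{-n}$ for all $|\lambda|>1$ and all integers $n\ge1$. A Banach lattice $X$ is $p$-convex if $\|(|f|^p+|g|^p)^{1/p}\|\le(\|f\|^p+\|g\|^p)^{1/p}$ for all $f,g\in X$, and $q$-concave if $(\|f\|^q+\|g\|^q)^{1/q}\le\|(|f|^q+|g|^q)^{1/q}\|$ for all $f,g\in X$, where expressions such as $(|f|^p+|g|^p)^{1/p}$ are defined through the Krivine functional calculus, with the usual modification (maximum/supremum) when the exponent is $\infty$. 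*)

theory Defs
  imports "HOL-Analysis.Analysis" "HOL-Library.Lattice_Algebras" "HOL-Library.Lub_Glb"
begin

section \<open>Real Banach lattices\<close>

class banach_lattice = banach + ordered_real_vector + lattice_ab_group_add_abs +
  assumes norm_mono_abs: "\<bar>x\<bar> \<le> \<bar>y\<bar> \<Longrightarrow> norm x \<le> norm y"

instance real :: banach_lattice
  by standard simp

lemma norm_abs_lattice [simp]: "norm \<bar>x\<bar> = norm (x::'a::banach_lattice)"
  by (simp add: norm_mono_abs antisym)

lemma norm_mono_nonneg: "0 \<le> x \<Longrightarrow> x \<le> y \<Longrightarrow> norm x \<le> norm (y::'a::banach_lattice)"
  by (intro norm_mono_abs) (simp add: order_trans[of 0 x y])

lemma scaleR_le_abs:
  fixes x :: "'a::banach_lattice"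
  assumes "\<bar>a\<bar> \<le> b"
  shows "a *\<^sub>R x \<le> b *\<^sub>R \<bar>x\<bar>"
proof -
  have "a *\<^sub>R x \<le> \<bar>a\<bar> *\<^sub>R \<bar>x\<bar>"
  proof (cases "a \<ge> 0")
    case True
    then show ?thesis by (simp add: scaleR_left_mono abs_ge_self)
  next
    case False
    then have "(- a) *\<^sub>R (- x) \<le> (- a) *\<^sub>R \<bar>x\<bar>"
      by (intro scaleR_left_mono abs_ge_minus_self) auto
    with False show ?thesis by simp
  qed
  also have "\<dots> \<le> b *\<^sub>R \<bar>x\<bar>"
    using assms by (intro scaleR_right_mono) auto
  finally show ?thesis .
qed

lemma abs_pprt_diff_le: "\<bar>pprt x - pprt y\<bar> \<le> \<bar>x - (y::'a::banach_lattice)\<bar>"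
proof -
  have *: "pprt a \<le> pprt b + \<bar>a - b\<bar>" for a b :: 'a
  proof -
    have "a \<le> b + \<bar>a - b\<bar>"
      using abs_ge_self[of "a - b"] by (simp add: algebra_simps)
    also have "\<dots> \<le> pprt b + \<bar>a - b\<bar>"
      by (simp add: pprt_def)
    finally show ?thesis
      using add_nonneg_nonneg[OF zero_le_pprt[of b] abs_ge_zero[of "a - b"]]
      by (simp add: pprt_def)
  qed
  show ?thesis
    using *[of x y] *[of y x] by (intro abs_leI) (simp_all add: algebra_simps abs_minus_commute)
qed

lemma tendsto_nonneg_lattice:
  fixes s :: "nat \<Rightarrow> 'a::banach_lattice"
  assumes "s \<longlonglongrightarrow> l" and "\<And>n. 0 \<le> s n"
  shows "0 \<le> l"
proof -
  have "(\<lambda>n. s n - l) \<longlonglongrightarrow> 0"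
    using assms(1) by (simp add: LIM_zero_iff)
  moreover have "norm (s n - pprt l) \<le> norm (s n - l)" for n
    using norm_mono_abs[OF abs_pprt_diff_le[of "s n" l]] assms(2)[of n]
    by (simp add: pprt_def sup_absorb1)
  ultimately have "(\<lambda>n. s n - pprt l) \<longlonglongrightarrow> 0"
    by (rule Lim_null_comparison[OF always_eventually[OF allI] tendsto_norm_zero, rotated])
  then have "s \<longlonglongrightarrow> pprt l"
    by (simp add: LIM_zero_iff)
  then have "l = pprt l"
    using assms(1) LIMSEQ_unique by blast
  then show ?thesis
    by (metis zero_le_pprt)
qed


section \<open>Complex Banach lattices\<close>

text \<open>
  A complex Banach lattice is the complexification of a real Banach lattice \<open>'a\<close>: its
  elements are \<open>x + i y\<close> with \<open>x\<close>, \<open>y\<close> in \<open>'a\<close>, its modulus is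
  \<open>\<bar>x + i y\<bar> = sup\<^sub>t (cos t x + sin t y)\<close> (this supremum always exists), and its norm is the
  norm of the modulus.
\<close>

datatype 'a complexification = Complexification (cRe: 'a) (cIm: 'a)

lemma complexification_eq_iff: "z = w \<longleftrightarrow> cRe z = cRe w \<and> cIm z = cIm w"
  by (rule complexification.expand[THEN iffI[rotated]]) auto

abbreviation rot :: "'a::real_vector complexification \<Rightarrow> real \<Rightarrow> 'a"
  where "rot z t \<equiv> cos t *\<^sub>R cRe z + sin t *\<^sub>R cIm z"

definition modulus :: "'a::banach_lattice complexification \<Rightarrow> 'a"
  where "modulus z = (THE u. isLub UNIV (range (rot z)) u)"

lemma rot_lipschitz:
  fixes z :: "'a::banach_lattice complexification"
  shows "rot z s \<le> rot z t + \<bar>s - t\<bar> *\<^sub>R (\<bar>cRe z\<bar> + \<bar>cIm z\<bar>)"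
proof -
  have c: "\<bar>cos s - cos t\<bar> \<le> \<bar>s - t\<bar>" and d: "\<bar>sin s - sin t\<bar> \<le> \<bar>s - t\<bar>"
  proof -
    have "norm (cos s - cos t) \<le> 1 * norm (s - t)"
      by (rule field_differentiable_bound[where S = UNIV and f' = "\<lambda>x. - sin x"])
         (auto intro!: derivative_eq_intros)
    then show "\<bar>cos s - cos t\<bar> \<le> \<bar>s - t\<bar>" by simp
    have "norm (sin s - sin t) \<le> 1 * norm (s - t)"
      by (rule field_differentiable_bound[where S = UNIV and f' = cos])
         (auto intro!: derivative_eq_intros)
    then show "\<bar>sin s - sin t\<bar> \<le> \<bar>s - t\<bar>" by simp
  qed
  from add_mono[OF scaleR_le_abs[OF c, of "cRe z"] scaleR_le_abs[OF d, of "cIm z"]]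
  show ?thesis by (simp add: algebra_simps)
qed

lemma ex_isLub_rot: "\<exists>u. isLub UNIV (range (rot z)) (u::'a::banach_lattice)"
proof -
  define u where "u = \<bar>cRe z\<bar> + \<bar>cIm z\<bar>"
  define e where "e n = 1 / real (Suc n)" for n
  define A where "A n = (\<lambda>k. real k * e n) ` {..7 * Suc n}" for n
  define s where "s n = Sup_fin (rot z ` A n)" for n
  have e: "e n > 0" for n by (simp add: e_def)
  have u: "0 \<le> u" by (simp add: u_def)
  have fin: "finite (rot z ` A n)" "rot z ` A n \<noteq> {}" for n
    by (auto simp: A_def)
  have net: "rot z t \<le> s n + e n *\<^sub>R u" for t n
  proof -
    obtain t' where t': "0 \<le> t'" "t' < 2 * pi" "cos t' = cos t" "sin t' = sin t"
      using sincos_total_2pi[of "cos t" "sin t"] sin_cos_squared_add2[of t] by metis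
    define k where "k = nat \<lfloor>t' * real (Suc n)\<rfloor>"
    have "0 \<le> t' * real (Suc n)" using t'(1) by simp
    then have k: "real k \<le> t' * real (Suc n)" "t' * real (Suc n) \<le> real k + 1"
      unfolding k_def by linarith+
    have "t' * real (Suc n) \<le> 7 * real (Suc n)"
      using t'(2) pi_less_4 pi_approx by (intro mult_right_mono) auto
    with k have "real k \<le> real (7 * Suc n)" by simp
    then have kn: "k \<le> 7 * Suc n" by linarith
    then have "rot z (real k * e n) \<le> s n"
      unfolding s_def by (intro Sup_fin.coboundedI fin) (auto simp: A_def)
    moreover have "\<bar>t' - real k * e n\<bar> \<le> e n"
    proof -
      have "t' - real k * e n = (t' * real (Suc n) - real k) * e n"
        by (simp add: e_def field_simps)
      moreover have "\<bar>t' * real (Suc n) - real k\<bar> * e n \<le> 1 * e n"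
        using k e[of n] by (intro mult_right_mono) (auto simp: abs_le_iff)
      ultimately show ?thesis
        using e[of n] by (simp add: abs_mult)
    qed
    then have "\<bar>t' - real k * e n\<bar> *\<^sub>R u \<le> e n *\<^sub>R u"
      using u by (rule scaleR_right_mono)
    moreover have "rot z t \<le> rot z (real k * e n) + \<bar>t' - real k * e n\<bar> *\<^sub>R u"
      using rot_lipschitz[where z = z and s = t' and t = "real k * e n"] t' by (simp add: u_def)
    ultimately show ?thesis
      by (meson add_mono order_trans)
  qed
  have bound: "s n \<le> v" if "\<And>t. rot z t \<le> v" for v n
    unfolding s_def using that by (intro Sup_fin.boundedI fin) auto
  have diff: "\<bar>s m - s n\<bar> \<le> (e m + e n) *\<^sub>R u" for m n
  proof -
    have *: "s i - s j \<le> (e i + e j) *\<^sub>R u" for i j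
    proof -
      have "s i \<le> s j + e j *\<^sub>R u" by (rule bound) (rule net)
      also have "\<dots> \<le> s j + (e i + e j) *\<^sub>R u"
        using u e[of i] by (intro add_left_mono scaleR_right_mono) auto
      finally show ?thesis by (simp add: algebra_simps)
    qed
    show ?thesis
      using *[of m n] *[of n m] by (intro abs_leI) (simp_all add: add.commute)
  qed
  have ndiff: "norm (s m - s n) \<le> (e m + e n) * norm u" for m n
  proof -
    have "norm (s m - s n) \<le> norm ((e m + e n) *\<^sub>R u)"
      using diff[of m n] e u by (intro norm_mono_abs)
        (metis abs_ge_zero abs_of_nonneg order_trans)
    then show ?thesis using e[of m] e[of n] by simp
  qed
  have e0: "e \<longlonglongrightarrow> 0"
    unfolding e_def using LIMSEQ_inverse_real_of_nat by (simp add: inverse_eq_divide)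
  have "Cauchy s"
  proof (rule metric_CauchyI)
    fix r :: real assume "0 < r"
    have "(\<lambda>n. e n * norm u) \<longlonglongrightarrow> 0 * norm u"
      by (intro tendsto_intros e0)
    then have "\<forall>\<^sub>F n in sequentially. e n * norm u < r / 2"
      using \<open>0 < r\<close> by (intro order_tendstoD(2)[where y = 0]) auto
    then obtain M where M: "\<And>n. n \<ge> M \<Longrightarrow> e n * norm u < r / 2"
      by (auto simp: eventually_sequentially)
    have "dist (s m) (s n) < r" if "m \<ge> M" "n \<ge> M" for m n
      using ndiff[of m n] M[OF that(1)] M[OF that(2)] by (simp add: dist_norm algebra_simps)
    then show "\<exists>M. \<forall>m\<ge>M. \<forall>n\<ge>M. dist (s m) (s n) < r" by blast
  qed
  then obtain l where l: "s \<longlonglongrightarrow> l"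
    using Cauchy_convergent convergent_def by blast
  have "rot z t \<le> l" for t
  proof -
    have "(\<lambda>n. s n + e n *\<^sub>R u - rot z t) \<longlonglongrightarrow> l + 0 *\<^sub>R u - rot z t"
      by (intro tendsto_intros l e0)
    from tendsto_nonneg_lattice[OF this] net show ?thesis by simp
  qed
  moreover have "l \<le> v" if "\<And>t. rot z t \<le> v" for v
  proof -
    have "(\<lambda>n. v - s n) \<longlonglongrightarrow> v - l"
      by (intro tendsto_intros l)
    from tendsto_nonneg_lattice[OF this] bound[OF that] show ?thesis by simp
  qed
  ultimately have "isLub UNIV (range (rot z)) l"
    by (auto simp: isLub_def leastP_def isUb_def setle_def setge_def)
  then show ?thesis ..
qed

lemma isLub_modulus: "isLub UNIV (range (rot z)) (modulus z)"
proof -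
  obtain u where u: "isLub UNIV (range (rot z)) u"
    using ex_isLub_rot by blast
  show ?thesis
    unfolding modulus_def
  proof (rule theI[of "isLub UNIV (range (rot z))", OF u])
    fix v assume "isLub UNIV (range (rot z)) v"
    with u show "v = u"
      by (auto simp: isLub_def leastP_def isUb_def setge_def intro: antisym)
  qed
qed

lemma rot_le_modulus: "rot z t \<le> modulus z"
  using isLub_modulus[of z] by (auto simp: isLub_def leastP_def isUb_def setle_def)

lemma modulus_least: "(\<And>t. rot z t \<le> v) \<Longrightarrow> modulus z \<le> v"
  using isLub_modulus[of z] by (auto simp: isLub_def leastP_def isUb_def setle_def setge_def)

lemma modulus_nonneg: "0 \<le> modulus z"
proof -
  have "0 \<le> modulus z + modulus z"
    using add_mono[OF rot_le_modulus[of 0 z] rot_le_modulus[of pi z]] by simp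
  then show ?thesis
    by simp
qed

lemma abs_cRe_le_modulus: "\<bar>cRe z\<bar> \<le> modulus z"
  using rot_le_modulus[of 0 z] rot_le_modulus[of pi z] by (intro abs_leI) auto

lemma abs_cIm_le_modulus: "\<bar>cIm z\<bar> \<le> modulus z"
  using rot_le_modulus[of "pi/2" z] rot_le_modulus[of "-pi/2" z] by (intro abs_leI) auto

lemma modulus_le_add: "modulus z \<le> \<bar>cRe z\<bar> + \<bar>cIm z\<bar>"
proof (rule modulus_least)
  fix t
  show "rot z t \<le> \<bar>cRe z\<bar> + \<bar>cIm z\<bar>"
    using scaleR_le_abs[of "cos t" 1 "cRe z"] scaleR_le_abs[of "sin t" 1 "cIm z"]
    by (intro add_mono) auto
qed

text \<open>\<open>z \<ge> 0\<close> means that \<open>z\<close> is real and in the positive cone of \<open>'a\<close>.\<close>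

instantiation complexification :: (banach_lattice) "{real_vector, order}"
begin

definition "0 = Complexification 0 0"
definition "z + w = Complexification (cRe z + cRe w) (cIm z + cIm w)"
definition "z - w = Complexification (cRe z - cRe w) (cIm z - cIm w)"
definition "- z = Complexification (- cRe z) (- cIm z)"
definition "r *\<^sub>R z = Complexification (r *\<^sub>R cRe z) (r *\<^sub>R cIm z)"
definition "z \<le> w \<longleftrightarrow> cRe z \<le> cRe w \<and> cIm z = cIm w"
definition "z < w \<longleftrightarrow> cRe z < cRe w \<and> cIm z = cIm w"

lemmas complexification_ops = zero_complexification_def plus_complexification_def
  minus_complexification_def uminus_complexification_def scaleR_complexification_def

instance
proof
  fix x y z :: "'a complexification"
  show "x < y \<longleftrightarrow> x \<le> y \<and> \<not> y \<le> x"
    by (auto simp: less_eq_complexification_def less_complexification_def)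
  show "x \<le> x" "x \<le> y \<Longrightarrow> y \<le> z \<Longrightarrow> x \<le> z" "x \<le> y \<Longrightarrow> y \<le> x \<Longrightarrow> x = y"
    by (auto simp: less_eq_complexification_def complexification_eq_iff)
qed (simp_all add: complexification_ops complexification_eq_iff scaleR_add_left scaleR_add_right ac_simps)

end

definition scaleC :: "complex \<Rightarrow> 'a::banach_lattice complexification \<Rightarrow> 'a complexification"
    (infixr \<open>*\<^sub>C\<close> 75)
  where "c *\<^sub>C z = Complexification (Re c *\<^sub>R cRe z - Im c *\<^sub>R cIm z) (Re c *\<^sub>R cIm z + Im c *\<^sub>R cRe z)"

lemma modulus_add_le: "modulus (z + w) \<le> modulus z + modulus w"
proof (rule modulus_least)
  fix t
  show "rot (z + w) t \<le> modulus z + modulus w"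
    using add_mono[OF rot_le_modulus[of t z] rot_le_modulus[of t w]]
    by (simp add: complexification_ops algebra_simps)
qed

lemma modulus_scaleC: "modulus (c *\<^sub>C z) = cmod c *\<^sub>R modulus z"
proof -
  have rot: "rot (c *\<^sub>C z) t = cmod c *\<^sub>R rot z (t - Arg c)" for c t and z :: "'a complexification"
  proof -
    have "Re c = cmod c * cos (Arg c)" "Im c = cmod c * sin (Arg c)"
      using rcis_cmod_Arg[of c] by (metis Re_rcis Im_rcis)+
    then have "c *\<^sub>C z = Complexification
        ((cmod c * cos (Arg c)) *\<^sub>R cRe z - (cmod c * sin (Arg c)) *\<^sub>R cIm z)
        ((cmod c * cos (Arg c)) *\<^sub>R cIm z + (cmod c * sin (Arg c)) *\<^sub>R cRe z)"
      by (simp add: scaleC_def)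
    then show ?thesis
      by (simp add: cos_diff sin_diff algebra_simps)
  qed
  have le: "modulus (c *\<^sub>C z) \<le> cmod c *\<^sub>R modulus z" for c and z :: "'a complexification"
    by (rule modulus_least) (simp only: rot, intro scaleR_left_mono rot_le_modulus norm_ge_zero)
  show ?thesis
  proof (cases "c = 0")
    case True
    then show ?thesis
      using le[of 0 z] modulus_nonneg[of "0 *\<^sub>C z"] by simp
  next
    case False
    have "inverse c *\<^sub>C c *\<^sub>C z = (inverse c * c) *\<^sub>C z"
      by (simp add: scaleC_def algebra_simps)
    then have "inverse c *\<^sub>C c *\<^sub>C z = z"
      using False by (simp add: scaleC_def)
    then have "modulus z \<le> inverse (cmod c) *\<^sub>R modulus (c *\<^sub>C z)"
      using le[of "inverse c" "c *\<^sub>C z"] by (simp add: norm_inverse)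
    then have "cmod c *\<^sub>R modulus z \<le> cmod c *\<^sub>R inverse (cmod c) *\<^sub>R modulus (c *\<^sub>C z)"
      by (rule scaleR_left_mono) simp
    then show ?thesis
      using le[of c z] False by (intro antisym) simp_all
  qed
qed

lemma scaleR_eq_scaleC: "r *\<^sub>R z = of_real r *\<^sub>C z"
  by (simp add: scaleC_def scaleR_complexification_def)

instantiation complexification :: (banach_lattice) real_normed_vector
begin

definition "norm z = norm (modulus z)"
definition "dist z w = norm (z - (w::'a complexification))"
definition "sgn z = (z::'a complexification) /\<^sub>R norm z"
definition [code del]:
  "uniformity = (INF e\<in>{0 <..}. principal {(z::'a complexification, w). dist z w < e})"
definition [code del]:
  "open U \<longleftrightarrow> (\<forall>z\<in>U. eventually (\<lambda>(z', w::'a complexification). z' = z \<longrightarrow> w \<in> U) uniformity)"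

instance
proof
  fix r :: real and z w :: "'a complexification"
  show "norm z = 0 \<longleftrightarrow> z = 0"
  proof
    assume "norm z = 0"
    then have "modulus z = 0" by (simp add: norm_complexification_def)
    then show "z = 0"
      using abs_cRe_le_modulus[of z] abs_cIm_le_modulus[of z]
      by (simp add: complexification_eq_iff complexification_ops)
  next
    assume "z = 0"
    then show "norm z = 0"
      using modulus_scaleC[of 0 z] scaleR_eq_scaleC[of 0 z] by (simp add: norm_complexification_def)
  qed
  show "norm (z + w) \<le> norm z + norm w"
    unfolding norm_complexification_def
    by (rule order_trans[OF norm_mono_nonneg[OF modulus_nonneg modulus_add_le] norm_triangle_ineq])
  show "norm (r *\<^sub>R z) = \<bar>r\<bar> * norm z"
    by (simp add: norm_complexification_def scaleR_eq_scaleC modulus_scaleC)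
qed (rule dist_complexification_def sgn_complexification_def
      uniformity_complexification_def open_complexification_def)+

end

lemma norm_scaleC: "norm (c *\<^sub>C z) = cmod c * norm z"
  by (simp add: norm_complexification_def modulus_scaleC)

lemma norm_cRe_le: "norm (cRe z) \<le> norm z"
  unfolding norm_complexification_def
  using norm_mono_nonneg[OF abs_ge_zero abs_cRe_le_modulus[of z]] by simp

lemma norm_cIm_le: "norm (cIm z) \<le> norm z"
  unfolding norm_complexification_def
  using norm_mono_nonneg[OF abs_ge_zero abs_cIm_le_modulus[of z]] by simp

lemma norm_le_cRe_cIm: "norm z \<le> norm (cRe z) + norm (cIm z)"
  unfolding norm_complexification_def
  using norm_mono_nonneg[OF modulus_nonneg modulus_le_add[of z]]
    norm_triangle_ineq[of "\<bar>cRe z\<bar>" "\<bar>cIm z\<bar>"] by simp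

instance complexification :: (banach_lattice) banach
proof
  fix s :: "nat \<Rightarrow> 'a complexification"
  assume s: "Cauchy s"
  have "Cauchy (\<lambda>n. cRe (s n))" "Cauchy (\<lambda>n. cIm (s n))"
  proof -
    have *: "norm (cRe (s m) - cRe (s n)) \<le> norm (s m - s n)"
      "norm (cIm (s m) - cIm (s n)) \<le> norm (s m - s n)" for m n
      using norm_cRe_le[of "s m - s n"] norm_cIm_le[of "s m - s n"]
      by (simp_all add: minus_complexification_def)
    show "Cauchy (\<lambda>n. cRe (s n))" "Cauchy (\<lambda>n. cIm (s n))"
      using s unfolding Cauchy_def dist_norm by (meson * order.strict_trans1)+
  qed
  then obtain x y where xy: "(\<lambda>n. cRe (s n)) \<longlonglongrightarrow> x" "(\<lambda>n. cIm (s n)) \<longlonglongrightarrow> y"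
    by (meson Cauchy_convergent convergentD)
  have "(\<lambda>n. norm (cRe (s n) - x) + norm (cIm (s n) - y)) \<longlonglongrightarrow> norm (x - x) + norm (y - y)"
    by (intro tendsto_intros xy)
  then have "(\<lambda>n. norm (cRe (s n) - x) + norm (cIm (s n) - y)) \<longlonglongrightarrow> 0"
    by simp
  moreover have "norm (s n - Complexification x y) \<le> norm (cRe (s n) - x) + norm (cIm (s n) - y)" for n
    using norm_le_cRe_cIm[of "s n - Complexification x y"] by (simp add: minus_complexification_def)
  ultimately have "(\<lambda>n. s n - Complexification x y) \<longlonglongrightarrow> 0"
    by (rule Lim_null_comparison[OF always_eventually[OF allI], rotated])
  then show "convergent s"
    by (auto simp: LIM_zero_iff convergent_def)
qed


section \<open>The Krivine functional calculus for two elements\<close>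

text \<open>Positively homogeneous continuous functions of two real variables.\<close>

definition krivine_functions :: "(real \<times> real \<Rightarrow> real) set"
  where "krivine_functions =
    {h. continuous_on UNIV h \<and> (\<forall>c v. 0 \<le> c \<longrightarrow> h (c *\<^sub>R v) = c * h v)}"

text \<open>Vector lattice homomorphisms on these functions sending the two coordinates to \<open>x\<close> and
  \<open>y\<close>. By Krivine's theorem, \<open>\<tau>\<close> exists and is unique on \<open>krivine_functions\<close>.\<close>

definition krivine_hom ::
    "'a::banach_lattice \<Rightarrow> 'a \<Rightarrow> ((real \<times> real \<Rightarrow> real) \<Rightarrow> 'a) \<Rightarrow> bool"
  where "krivine_hom x y \<tau> \<longleftrightarrow>
    \<tau> fst = x \<and> \<tau> snd = y \<and>
    (\<forall>h\<in>krivine_functions. \<forall>k\<in>krivine_functions.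
      \<tau> (\<lambda>v. h v + k v) = \<tau> h + \<tau> k \<and>
      \<tau> (\<lambda>v. max (h v) (k v)) = sup (\<tau> h) (\<tau> k) \<and>
      \<tau> (\<lambda>v. min (h v) (k v)) = inf (\<tau> h) (\<tau> k)) \<and>
    (\<forall>h\<in>krivine_functions. \<forall>c. \<tau> (\<lambda>v. c * h v) = c *\<^sub>R \<tau> h)"

definition krivine :: "(real \<times> real \<Rightarrow> real) \<Rightarrow> 'a::banach_lattice \<Rightarrow> 'a \<Rightarrow> 'a"
  where "krivine h x y = (THE u. \<exists>\<tau>. krivine_hom x y \<tau> \<and> u = \<tau> h)"


section \<open>Convexity and concavity\<close>

text \<open>\<open>(\<bar>s\<bar>\<^sup>p + \<bar>t\<bar>\<^sup>p)\<^sup>1\<^sup>/\<^sup>p\<close>, read as the maximum for \<open>p = \<infinity>\<close>.\<close>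

definition lp_sum :: "ennreal \<Rightarrow> real \<times> real \<Rightarrow> real"
  where "lp_sum p v =
    (if p = \<infinity> then max \<bar>fst v\<bar> \<bar>snd v\<bar>
     else (\<bar>fst v\<bar> powr enn2real p + \<bar>snd v\<bar> powr enn2real p) powr (1 / enn2real p))"

definition p_convex :: "'a::banach_lattice itself \<Rightarrow> ennreal \<Rightarrow> bool"
  where "p_convex _ p \<longleftrightarrow>
    (\<forall>f g :: 'a complexification.
      norm (krivine (lp_sum p) (modulus f) (modulus g)) \<le> lp_sum p (norm f, norm g))"

definition q_concave :: "'a::banach_lattice itself \<Rightarrow> ennreal \<Rightarrow> bool"
  where "q_concave _ q \<longleftrightarrow>
    (\<forall>f g :: 'a complexification.
      lp_sum q (norm f, norm g) \<le> norm (krivine (lp_sum q) (modulus f) (modulus g)))"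


section \<open>Operators\<close>

definition bounded_clinear ::
    "('a::banach_lattice complexification \<Rightarrow> 'a complexification) \<Rightarrow> bool"
  where "bounded_clinear T \<longleftrightarrow> bounded_linear T \<and> (\<forall>c z. T (c *\<^sub>C z) = c *\<^sub>C T z)"

definition positive_operator ::
    "('a::banach_lattice complexification \<Rightarrow> 'a complexification) \<Rightarrow> bool"
  where "positive_operator T \<longleftrightarrow> (\<forall>f\<ge>0. T f \<ge> 0)"

definition resolvent_set ::
    "('a::banach_lattice complexification \<Rightarrow> 'a complexification) \<Rightarrow> complex set"
  where "resolvent_set T = {\<mu>. bij (\<lambda>z. \<mu> *\<^sub>C z - T z) \<and> bounded_clinear (inv (\<lambda>z. \<mu> *\<^sub>C z - T z))}"

definition resolvent ::
    "('a::banach_lattice complexification \<Rightarrow> 'a complexification) \<Rightarrow> complex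
      \<Rightarrow> 'a complexification \<Rightarrow> 'a complexification"
  where "resolvent T \<mu> = inv (\<lambda>z. \<mu> *\<^sub>C z - T z)"

definition strongly_Kreiss_bounded ::
    "('a::banach_lattice complexification \<Rightarrow> 'a complexification) \<Rightarrow> real \<Rightarrow> bool"
  where "strongly_Kreiss_bounded T K \<longleftrightarrow>
    (\<forall>\<mu>. cmod \<mu> > 1 \<longrightarrow> \<mu> \<in> resolvent_set T \<and>
      (\<forall>n\<ge>1. onorm (resolvent T \<mu> ^^ n) \<le> K / (cmod \<mu> - 1) ^ n))"

end

theory Submission
  imports Defs "HOL-Library.Discrete_Functions"
begin

text \<open>
  If \<open>X\<close> is \<open>p\<close>-convex, then positive \<open>f\<^sub>1, \<dots>, f\<^sub>w\<close> with norms at most \<open>B\<close> lie below some \<open>g\<close> with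
  \<open>\<parallel>g\<parallel> \<le> w\<^sup>1\<^sup>/\<^sup>p B\<close>. The strong Kreiss condition gives \<open>\<parallel>exp (t T)\<parallel> \<le> K exp t\<close>, because \<open>exp (t T)\<close> is the
  limit of \<open>(1 - t T / n)\<^sup>-\<^sup>n\<close>. For positive \<open>T\<close> and \<open>t = n\<close>, the Poisson weights are of order
  \<open>1 / sqrt n\<close> on a window of length \<open>w = \<lfloor>sqrt n\<rfloor>\<close> below \<open>n\<close>, so
  \<open>\<parallel>\<Sum>m<w. T\<^sup>n\<^sup>-\<^sup>m g\<parallel> \<le> C w \<parallel>g\<parallel>\<close> for \<open>g \<ge> 0\<close>.
  Writing \<open>w T\<^sup>n f = \<Sum>m<w. T\<^sup>n\<^sup>-\<^sup>m (T\<^sup>m f) \<le> \<Sum>m<w. T\<^sup>n\<^sup>-\<^sup>m g\<close>, with \<open>g\<close> an upper bound of the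
  \<open>T\<^sup>m f\<close>, yields \<open>\<parallel>T\<^sup>n\<parallel> \<le> C w\<^sup>1\<^sup>/\<^sup>p max\<^sub>m\<^sub><\<^sub>w \<parallel>T\<^sup>m\<parallel>\<close>. Iterating from \<open>n\<close> to \<open>sqrt n\<close>, the powers
  multiply to \<open>n\<^sup>1\<^sup>/\<^sup>p\<close> and the constants to \<open>C\<close> to the power \<open>O(log log n)\<close>, which is a power of
  \<open>log n\<close>. For \<open>q\<close>-concave \<open>X\<close> one argues in the same way, bounding
  \<open>\<parallel>T\<^sup>n f\<parallel>\<close> by \<open>\<parallel>T\<^sup>m\<parallel> \<parallel>T\<^sup>n\<^sup>-\<^sup>m f\<parallel>\<close> and using the lower \<open>q\<close>-estimate on the window.
\<close>

section \<open>The lattice version of the Stone--Weierstrass theorem\<close>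

text \<open>Compactness: each point of \<open>K\<close> has a member of \<open>G\<close> that
  exceeds \<open>h\<close> on a neighbourhood; finitely many of these neighbourhoods cover
  \<open>K\<close>, and the maximum of the chosen functions exceeds \<open>h\<close> on all of
  \<open>K\<close>.\<close>

lemma max_closed_dominates:
  fixes h :: "'a::topological_space \<Rightarrow> real"
  assumes "compact K" "K \<noteq> {}" "continuous_on K h"
    and cont: "\<And>f. f \<in> G \<Longrightarrow> continuous_on K f"
    and max: "\<And>f g. f \<in> G \<Longrightarrow> g \<in> G \<Longrightarrow> (\<lambda>v. max (f v) (g v)) \<in> G"
    and pt: "\<And>q. q \<in> K \<Longrightarrow> \<exists>f\<in>G. h q < f q"
  shows "\<exists>f\<in>G. \<forall>v\<in>K. h v < f v"
proof -
  obtain \<phi> where \<phi>: "\<And>q. q \<in> K \<Longrightarrow> \<phi> q \<in> G \<and> h q < \<phi> q q"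
    using pt by metis
  have "\<exists>U. open U \<and> U \<inter> K = {v \<in> K. h v < \<phi> q v}" if "q \<in> K" for q
  proof -
    have "continuous_on K (\<lambda>v. \<phi> q v - h v)"
      using \<phi>[OF that] cont assms(3) by (intro continuous_intros) auto
    then obtain A where "open A" "A \<inter> K = (\<lambda>v. \<phi> q v - h v) -` {0<..} \<inter> K"
      unfolding continuous_on_open_invariant using open_greaterThan by blast
    then show ?thesis by (intro exI[of _ A]) auto
  qed
  then obtain U where U: "\<And>q. q \<in> K \<Longrightarrow> open (U q) \<and> U q \<inter> K = {v \<in> K. h v < \<phi> q v}"
    by metis
  have "K \<subseteq> (\<Union>q\<in>K. U q)" using U \<phi> by blast
  then obtain C where C: "C \<subseteq> K" "finite C" "K \<subseteq> (\<Union>q\<in>C. U q)"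
    using compactE_image[OF assms(1), of K U] U by blast
  have "C \<noteq> {}" using C assms(2) by auto
  have "\<exists>f\<in>G. \<forall>q\<in>C. \<forall>v. \<phi> q v \<le> f v"
    using C(2) \<open>C \<noteq> {}\<close> C(1)
  proof (induction C rule: finite_ne_induct)
    case (singleton q)
    then show ?case using \<phi> by auto
  next
    case (insert q C)
    then obtain f where f: "f \<in> G" "\<forall>q\<in>C. \<forall>v. \<phi> q v \<le> f v" by auto
    have "(\<lambda>v. max (\<phi> q v) (f v)) \<in> G" using insert f \<phi> by (intro max) auto
    then show ?case using f(2) by (rule_tac bexI) (auto simp: le_max_iff_disj)
  qed
  then obtain f where f: "f \<in> G" "\<forall>q\<in>C. \<forall>v. \<phi> q v \<le> f v" by blast
  have "h v < f v" if v: "v \<in> K" for v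
  proof -
    obtain q where "q \<in> C" "v \<in> U q" using C v by blast
    then have "h v < \<phi> q v" using U C v by blast
    then show ?thesis using f \<open>q \<in> C\<close> by (meson less_le_trans)
  qed
  then show ?thesis using f by blast
qed

text \<open>Two passes of \<open>max_closed_dominates\<close>. For fixed \<open>p\<close>, maxima of
  interpolants through \<open>p\<close> give a function above \<open>h - e\<close> that agrees with
  \<open>h\<close> at \<open>p\<close>. Minima of these functions over varying \<open>p\<close> then
  stay above \<open>h - e\<close> and fall below \<open>h + e\<close>.\<close>

theorem lattice_Stone_Weierstrass:
  fixes h :: "'a::topological_space \<Rightarrow> real"
  assumes "compact K" "K \<noteq> {}" "continuous_on K h" "0 < e"
    and cont: "\<And>f. f \<in> F \<Longrightarrow> continuous_on K f"
    and max: "\<And>f g. f \<in> F \<Longrightarrow> g \<in> F \<Longrightarrow> (\<lambda>v. max (f v) (g v)) \<in> F"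
    and min: "\<And>f g. f \<in> F \<Longrightarrow> g \<in> F \<Longrightarrow> (\<lambda>v. min (f v) (g v)) \<in> F"
    and interp: "\<And>p q. p \<in> K \<Longrightarrow> q \<in> K \<Longrightarrow> \<exists>f\<in>F. f p = h p \<and> f q = h q"
  shows "\<exists>f\<in>F. \<forall>v\<in>K. \<bar>h v - f v\<bar> < e"
proof -
  have 1: "\<exists>f\<in>F. f p = h p \<and> (\<forall>v\<in>K. h v - e < f v)" if p: "p \<in> K" for p
  proof -
    have "\<exists>f\<in>{f \<in> F. f p = h p}. \<forall>v\<in>K. h v - e < f v"
    proof (rule max_closed_dominates[OF assms(1,2)])
      show "\<exists>f\<in>{f \<in> F. f p = h p}. h q - e < f q" if "q \<in> K" for q
        using interp[OF p that] \<open>0 < e\<close> by auto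
    qed (use cont max assms(3) in \<open>auto intro!: continuous_intros\<close>)
    then show ?thesis by blast
  qed
  \<comment> \<open>The negatives of the members of \<open>F\<close> that lie above
    \<open>h - e\<close> on \<open>K\<close>. Maxima in \<open>G\<close> are minima in
    \<open>F\<close>, so the second pass can use the same lemma, with \<open>- h\<close> shifted by
    \<open>e\<close>.\<close>
  define G where "G = {f. (\<lambda>v. - f v) \<in> F \<and> (\<forall>v\<in>K. f v < e - h v)}"
  have "\<exists>f\<in>G. \<forall>v\<in>K. - h v - e < f v"
  proof (rule max_closed_dominates[OF assms(1,2)])
    show "continuous_on K f" if "f \<in> G" for f
      using continuous_on_minus[OF cont[of "\<lambda>v. - f v"]] that by (simp add: G_def)
    show "(\<lambda>v. max (f v) (g v)) \<in> G" if "f \<in> G" "g \<in> G" for f g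
      using min[of "\<lambda>v. - f v" "\<lambda>v. - g v"] that by (simp add: G_def minus_max_eq_min)
    show "\<exists>f\<in>G. - h q - e < f q" if q: "q \<in> K" for q
    proof -
      obtain f where "f \<in> F" "f q = h q" "\<forall>v\<in>K. h v - e < f v" using 1 q by blast
      then show ?thesis using \<open>0 < e\<close>
        by (intro bexI[of _ "\<lambda>v. - f v"]) (auto simp: G_def algebra_simps)
    qed
  qed (use assms(3) in \<open>intro continuous_intros\<close>)
  then obtain f where f: "f \<in> G" "\<forall>v\<in>K. - h v - e < f v" by blast
  then show ?thesis
    by (intro bexI[of _ "\<lambda>v. - f v"]) (fastforce simp: G_def abs_less_iff)+
qed

section \<open>The Krivine calculus\<close>

lemma scaleR_sup:
  fixes x y :: "'a::banach_lattice"
  assumes "0 \<le> c"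
  shows "c *\<^sub>R sup x y = sup (c *\<^sub>R x) (c *\<^sub>R y)"
proof (cases "c = 0")
  case False
  with assms have c: "0 < c" by simp
  show ?thesis
  proof (rule antisym)
    have *: "z \<le> inverse c *\<^sub>R sup (c *\<^sub>R x) (c *\<^sub>R y)" if "c *\<^sub>R z \<le> sup (c *\<^sub>R x) (c *\<^sub>R y)" for z
      using scaleR_left_mono[OF that, of "inverse c"] c by simp
    have "sup x y \<le> inverse c *\<^sub>R sup (c *\<^sub>R x) (c *\<^sub>R y)"
      by (intro sup_least *) auto
    from scaleR_left_mono[OF this assms] show "c *\<^sub>R sup x y \<le> sup (c *\<^sub>R x) (c *\<^sub>R y)"
      using c by simp
  qed (intro sup_least scaleR_left_mono assms sup_ge1 sup_ge2)
qed simp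

text \<open>A relation and not a function, since one function can be written as a maximum of linear
  forms in several ways. That the lattice element depends on the function alone follows from
  \<open>lin_sup_mono\<close>.\<close>

inductive lin_sup ::
    "'a::banach_lattice \<Rightarrow> 'a \<Rightarrow> (real \<times> real \<Rightarrow> real) \<Rightarrow> 'a \<Rightarrow> bool" for x y
where
  lin: "lin_sup x y (\<lambda>v. w \<bullet> v) (fst w *\<^sub>R x + snd w *\<^sub>R y)"
| sup: "lin_sup x y f z \<Longrightarrow> lin_sup x y g w \<Longrightarrow> lin_sup x y (\<lambda>v. max (f v) (g v)) (sup z w)"

text \<open>\<open>A\<close> collects the coefficient vectors of the forms in the maximum. The two
  one-sided facts are those that the separation argument uses.\<close>

lemma lin_sup_minorants:
  assumes "lin_sup x y g w"
  shows "\<exists>A. finite A \<and> A \<noteq> {} \<and> (\<forall>a\<in>A. fst a *\<^sub>R x + snd a *\<^sub>R y \<le> w) \<and>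
    (\<forall>v. \<exists>a\<in>A. g v \<le> a \<bullet> v)"
  using assms
proof induction
  case (lin w)
  then show ?case by (intro exI[of _ "{w}"]) auto
next
  case (sup f z g w)
  obtain A where A: "finite A" "A \<noteq> {}" "\<forall>a\<in>A. fst a *\<^sub>R x + snd a *\<^sub>R y \<le> z"
    "\<forall>v. \<exists>a\<in>A. f v \<le> a \<bullet> v"
    using sup.IH(1) by blast
  obtain B where B: "finite B" "\<forall>a\<in>B. fst a *\<^sub>R x + snd a *\<^sub>R y \<le> w" "\<forall>v. \<exists>a\<in>B. g v \<le> a \<bullet> v"
    using sup.IH(2) by blast
  have "\<exists>a\<in>A \<union> B. max (f v) (g v) \<le> a \<bullet> v" for v
  proof (cases "f v \<le> g v")
    case True
    then show ?thesis using B(3) by (metis UnI2 max.absorb2)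
  next
    case False
    then show ?thesis using A(4) by (metis UnI1 max.absorb1 linear)
  qed
  then show ?case
    using A B by (intro exI[of _ "A \<union> B"]) (simp add: ball_Un le_supI1 le_supI2)
qed

text \<open>By separation in the plane, a linear form below a maximum of finitely many linear forms is
  below a convex combination of them.\<close>

lemma lin_le_lin_sup:
  assumes "lin_sup x y g w" and le: "\<And>v. a \<bullet> v \<le> g v"
  shows "fst a *\<^sub>R x + snd a *\<^sub>R y \<le> w"
proof -
  obtain A where A: "finite A" "A \<noteq> {}" "\<And>a. a \<in> A \<Longrightarrow> fst a *\<^sub>R x + snd a *\<^sub>R y \<le> w"
    "\<And>v. \<exists>a\<in>A. g v \<le> a \<bullet> v"
    using lin_sup_minorants[OF assms(1)] by blast
  have "a \<in> convex hull A"
  proof (rule ccontr)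
    assume "a \<notin> convex hull A"
    then obtain d b where d: "d \<bullet> a < b" "\<And>c. c \<in> convex hull A \<Longrightarrow> d \<bullet> c > b"
      using separating_hyperplane_closed_point[of "convex hull A" a] A(1)
      by (auto simp: finite_imp_compact_convex_hull compact_imp_closed)
    \<comment> \<open>At \<open>- d\<close> every form with coefficients in the hull is below
      \<open>- b\<close>, while the form of \<open>a\<close> is above \<open>- b\<close>. This
      contradicts \<open>a \<bullet> v \<le> g v\<close> at \<open>v = - d\<close>.\<close>
    obtain c where "c \<in> A" "g (- d) \<le> c \<bullet> (- d)" using A(4) by blast
    with d(1) d(2)[OF hull_inc[of c A]] le[of "- d"] show False
      by (simp add: inner_commute)
  qed
  moreover have "convex {a. fst a *\<^sub>R x + snd a *\<^sub>R y \<le> w}"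
  proof (rule convexI, clarsimp)
    fix a b c d and u v :: real
    assume *: "a *\<^sub>R x + b *\<^sub>R y \<le> w" "c *\<^sub>R x + d *\<^sub>R y \<le> w" "0 \<le> u" "0 \<le> v" "u + v = 1"
    have "u *\<^sub>R (a *\<^sub>R x + b *\<^sub>R y) + v *\<^sub>R (c *\<^sub>R x + d *\<^sub>R y) \<le> u *\<^sub>R w + v *\<^sub>R w"
      using * by (intro add_mono scaleR_left_mono)
    also have "\<dots> = w" using *(5) by (metis scaleR_add_left scaleR_one)
    finally show "(u * a + v * c) *\<^sub>R x + (u * b + v * d) *\<^sub>R y \<le> w"
      by (simp add: algebra_simps)
  qed
  ultimately show ?thesis
    using hull_minimal[of A "{a. fst a *\<^sub>R x + snd a *\<^sub>R y \<le> w}" convex] A(3) by blast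
qed

lemma lin_sup_mono:
  assumes "lin_sup x y f z" "lin_sup x y g w" "\<And>v. f v \<le> g v"
  shows "z \<le> w"
  using assms(1,3)
proof induction
  case (lin a)
  then show ?case by (rule lin_le_lin_sup[OF assms(2)])
next
  case (sup f z h u)
  then show ?case by (meson max.bounded_iff sup_least)
qed

lemma lin_sup_add:
  assumes "lin_sup x y f z" "lin_sup x y g w"
  shows "lin_sup x y (\<lambda>v. f v + g v) (z + w)"
  using assms(1)
proof induction
  case (lin a)
  show ?case using assms(2)
  proof induction
    case (lin b)
    then show ?case using lin_sup.lin[of x y "a + b"] by (simp add: inner_add_left algebra_simps)
  next
    case (sup f z g w)
    from lin_sup.sup[OF sup.IH] show ?case by (simp add: add_sup_distrib_left max_add_distrib_right)
  qed
next
  case (sup f z g w)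
  from lin_sup.sup[OF sup.IH] show ?case by (simp add: add_sup_distrib_right max_add_distrib_left)
qed

lemma lin_sup_scale:
  assumes "lin_sup x y f z" "0 \<le> c"
  shows "lin_sup x y (\<lambda>v. c * f v) (c *\<^sub>R z)"
  using assms(1)
proof induction
  case (lin a)
  then show ?case using lin_sup.lin[of x y "c *\<^sub>R a"] by (simp add: algebra_simps)
next
  case (sup f z g w)
  from lin_sup.sup[OF sup.IH] show ?case
    using assms(2) by (simp add: scaleR_sup max_mult_distrib_left)
qed

section \<open>Differences of such maxima: the vector lattice generated by the coordinates\<close>

definition dlin_sup ::
    "'a::banach_lattice \<Rightarrow> 'a \<Rightarrow> (real \<times> real \<Rightarrow> real) \<Rightarrow> 'a \<Rightarrow> bool"
  where "dlin_sup x y f z \<longleftrightarrow>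
    (\<exists>f1 z1 f2 z2. lin_sup x y f1 z1 \<and> lin_sup x y f2 z2 \<and> f = (\<lambda>v. f1 v - f2 v) \<and> z = z1 - z2)"

lemma dlin_sup_lin: "dlin_sup x y (\<lambda>v. w \<bullet> v) (fst w *\<^sub>R x + snd w *\<^sub>R y)"
  unfolding dlin_sup_def
  by (intro exI conjI, rule lin_sup.lin[of x y w], rule lin_sup.lin[of x y 0]) simp_all

text \<open>Moving the subtracted terms to the other side reduces this to
  \<open>lin_sup_mono\<close>. In particular the value does not depend on the chosen
  difference.\<close>

lemma dlin_sup_mono:
  assumes "dlin_sup x y f z" "dlin_sup x y g w" "\<And>v. f v \<le> g v"
  shows "z \<le> w"
proof -
  obtain f1 z1 f2 z2 g1 w1 g2 w2 where
    *: "lin_sup x y f1 z1" "lin_sup x y f2 z2" "f = (\<lambda>v. f1 v - f2 v)" "z = z1 - z2"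
    "lin_sup x y g1 w1" "lin_sup x y g2 w2" "g = (\<lambda>v. g1 v - g2 v)" "w = w1 - w2"
    using assms(1,2) unfolding dlin_sup_def by blast
  have "z1 + w2 \<le> w1 + z2"
    by (rule lin_sup_mono[OF lin_sup_add[OF *(1,6)] lin_sup_add[OF *(5,2)]])
      (use assms(3) * in \<open>simp add: algebra_simps\<close>)
  from add_right_mono[OF this, of "- (z2 + w2)"] show ?thesis
    unfolding *(4,8) by (simp add: add.assoc[symmetric])
qed

lemma dlin_sup_add:
  assumes "dlin_sup x y f z" "dlin_sup x y g w"
  shows "dlin_sup x y (\<lambda>v. f v + g v) (z + w)"
proof -
  obtain f1 z1 f2 z2 g1 w1 g2 w2 where
    *: "lin_sup x y f1 z1" "lin_sup x y f2 z2" "f = (\<lambda>v. f1 v - f2 v)" "z = z1 - z2"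
    "lin_sup x y g1 w1" "lin_sup x y g2 w2" "g = (\<lambda>v. g1 v - g2 v)" "w = w1 - w2"
    using assms(1,2) unfolding dlin_sup_def by blast
  show ?thesis unfolding dlin_sup_def
    by (rule exI[of _ "\<lambda>v. f1 v + g1 v"], rule exI[of _ "z1 + w1"],
        rule exI[of _ "\<lambda>v. f2 v + g2 v"], rule exI[of _ "z2 + w2"])
      (auto simp: * intro!: lin_sup_add)
qed

lemma dlin_sup_uminus:
  assumes "dlin_sup x y f z"
  shows "dlin_sup x y (\<lambda>v. - f v) (- z)"
proof -
  obtain f1 z1 f2 z2 where
    *: "lin_sup x y f1 z1" "lin_sup x y f2 z2" "f = (\<lambda>v. f1 v - f2 v)" "z = z1 - z2"
    using assms unfolding dlin_sup_def by blast
  then show ?thesis unfolding dlin_sup_def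
    by (intro exI[of _ f2] exI[of _ z2] exI[of _ f1] exI[of _ z1]) simp
qed

lemma dlin_sup_scale:
  assumes "dlin_sup x y f z"
  shows "dlin_sup x y (\<lambda>v. c * f v) (c *\<^sub>R z)"
proof -
  have *: "dlin_sup x y (\<lambda>v. c * f v) (c *\<^sub>R z)" if f: "dlin_sup x y f z" and c: "0 \<le> c" for c f z
  proof -
    obtain f1 z1 f2 z2 where
      *: "lin_sup x y f1 z1" "lin_sup x y f2 z2" "f = (\<lambda>v. f1 v - f2 v)" "z = z1 - z2"
      using f unfolding dlin_sup_def by blast
    show ?thesis unfolding dlin_sup_def
      by (intro exI[of _ "\<lambda>v. c * f1 v"] exI[of _ "c *\<^sub>R z1"] exI[of _ "\<lambda>v. c * f2 v"]
          exI[of _ "c *\<^sub>R z2"])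
        (simp add: lin_sup_scale * c scaleR_diff_right right_diff_distrib)
  qed
  show ?thesis
    using *[OF assms, of c] *[OF dlin_sup_uminus[OF assms], of "- c"] by (cases "0 \<le> c") auto
qed

text \<open>Translation by \<open>f2 + g2\<close> turns a maximum of differences into a maximum of
  sums: \<open>max (f1 - f2) (g1 - g2) = max (f1 + g2) (g1 + f2) - (f2 + g2)\<close>, and likewise
  for \<open>sup\<close> in the lattice.\<close>

lemma dlin_sup_sup:
  assumes "dlin_sup x y f z" "dlin_sup x y g w"
  shows "dlin_sup x y (\<lambda>v. max (f v) (g v)) (sup z w)"
proof -
  obtain f1 z1 f2 z2 g1 w1 g2 w2 where
    *: "lin_sup x y f1 z1" "lin_sup x y f2 z2" "f = (\<lambda>v. f1 v - f2 v)" "z = z1 - z2"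
    "lin_sup x y g1 w1" "lin_sup x y g2 w2" "g = (\<lambda>v. g1 v - g2 v)" "w = w1 - w2"
    using assms(1,2) unfolding dlin_sup_def by blast
  have "sup z w = sup (z1 + w2) (w1 + z2) - (z2 + w2)"
    using add_sup_distrib_right[of "z1 + w2" "w1 + z2" "- (z2 + w2)"] by (simp add: * algebra_simps)
  then show ?thesis unfolding dlin_sup_def
    by (intro exI[of _ "\<lambda>v. max (f1 v + g2 v) (g1 v + f2 v)"] exI[of _ "sup (z1 + w2) (w1 + z2)"]
        exI[of _ "\<lambda>v. f2 v + g2 v"] exI[of _ "z2 + w2"])
      (auto intro!: lin_sup_add lin_sup.sup * simp: *(3,7) fun_eq_iff)
qed

lemma dlin_sup_inf:
  assumes "dlin_sup x y f z" "dlin_sup x y g w"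
  shows "dlin_sup x y (\<lambda>v. min (f v) (g v)) (inf z w)"
  using dlin_sup_uminus[OF dlin_sup_sup[OF assms[THEN dlin_sup_uminus]]]
  by (simp only: inf_eq_neg_sup[of z] minus_max_eq_min minus_minus)

lemma dlin_sup_abs:
  assumes "dlin_sup x y f z"
  shows "dlin_sup x y (\<lambda>v. \<bar>f v\<bar>) \<bar>z\<bar>"
proof -
  have "(\<lambda>v. \<bar>f v\<bar>) = (\<lambda>v. max (f v) (- f v))" by (auto simp: fun_eq_iff)
  then show ?thesis
    using dlin_sup_sup[OF assms dlin_sup_uminus[OF assms]] by (simp add: abs_lattice)
qed

lemma dlin_sup_fst: "dlin_sup x y fst x" and dlin_sup_snd: "dlin_sup x y snd y"
  using dlin_sup_lin[of x y "(1, 0)"] dlin_sup_lin[of x y "(0, 1)"] by (simp_all add: inner_prod_def)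

text \<open>The positive cone is closed, so \<open>e\<close> can tend to 0.\<close>

lemma le_if_le_add_scaleR:
  fixes z w u :: "'a::banach_lattice"
  assumes "\<And>e. 0 < e \<Longrightarrow> z \<le> w + e *\<^sub>R u"
  shows "z \<le> w"
proof -
  have "(\<lambda>n. w + inverse (real (Suc n)) *\<^sub>R u - z) \<longlonglongrightarrow> w + 0 *\<^sub>R u - z"
    by (intro tendsto_intros LIMSEQ_inverse_real_of_nat)
  from tendsto_nonneg_lattice[OF this] assms[of "inverse (real (Suc _))"] show ?thesis
    by simp
qed

section \<open>Density in the positively homogeneous continuous functions\<close>

lemma krivine_functions_fst: "fst \<in> krivine_functions"
  and krivine_functions_snd: "snd \<in> krivine_functions"
  by (auto simp: krivine_functions_def intro!: continuous_intros)

lemma krivine_functions_add: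
  "h \<in> krivine_functions \<Longrightarrow> k \<in> krivine_functions \<Longrightarrow> (\<lambda>v. h v + k v) \<in> krivine_functions"
  by (auto simp: krivine_functions_def distrib_left intro!: continuous_intros)

lemma krivine_functions_scale:
  "h \<in> krivine_functions \<Longrightarrow> (\<lambda>v. c * h v) \<in> krivine_functions"
  by (auto simp: krivine_functions_def intro!: continuous_intros)

lemma krivine_functions_uminus:
  "h \<in> krivine_functions \<Longrightarrow> (\<lambda>v. - h v) \<in> krivine_functions"
  using krivine_functions_scale[of h "-1"] by simp

lemma krivine_functions_max:
  "h \<in> krivine_functions \<Longrightarrow> k \<in> krivine_functions \<Longrightarrow> (\<lambda>v. max (h v) (k v)) \<in> krivine_functions"
  by (auto simp: krivine_functions_def max_mult_distrib_left intro!: continuous_intros)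

lemma krivine_functions_abs:
  "h \<in> krivine_functions \<Longrightarrow> (\<lambda>v. \<bar>h v\<bar>) \<in> krivine_functions"
  by (auto simp: krivine_functions_def abs_mult intro!: continuous_intros)

lemma krivine_functions_lin_sup:
  "lin_sup x y f z \<Longrightarrow> f \<in> krivine_functions"
proof (induction rule: lin_sup.induct)
  case (lin w)
  then show ?case
    unfolding krivine_functions_def
    by (simp add: inner_scaleR_right del: split_paired_All)
      (intro continuous_intros)
qed (rule krivine_functions_max)

lemma krivine_functions_dlin_sup:
  assumes "dlin_sup x y f z"
  shows "f \<in> krivine_functions"
proof -
  obtain f1 z1 f2 z2 where
    *: "lin_sup x y f1 z1" "lin_sup x y f2 z2" "f = (\<lambda>v. f1 v - f2 v)" "z = z1 - z2"
    using assms unfolding dlin_sup_def by blast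
  show ?thesis
    using krivine_functions_add[OF _ krivine_functions_uminus, OF *(1,2)[THEN krivine_functions_lin_sup]]
    by (simp add: *(3))
qed

lemma dlin_sup_taxicab: "dlin_sup x y (\<lambda>v. \<bar>fst v\<bar> + \<bar>snd v\<bar>) (\<bar>x\<bar> + \<bar>y\<bar>)"
  by (intro dlin_sup_add dlin_sup_abs dlin_sup_fst dlin_sup_snd)

lemma dlin_sup_le_add:
  assumes "dlin_sup x y f z" "dlin_sup x y g w" "\<And>v. f v \<le> g v + e * (\<bar>fst v\<bar> + \<bar>snd v\<bar>)"
  shows "z \<le> w + e *\<^sub>R (\<bar>x\<bar> + \<bar>y\<bar>)"
  by (rule dlin_sup_mono[OF assms(1) dlin_sup_add[OF assms(2) dlin_sup_scale[OF dlin_sup_taxicab]]])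
    (rule assms(3))

text \<open>Lattice Stone-Weierstrass on the unit circle, carried to the plane by homogeneity. The
  error is measured by the taxicab norm because the calculus sends that function to
  \<open>\<bar>x\<bar> + \<bar>y\<bar>\<close>.\<close>

lemma dlin_sup_dense:
  assumes h: "h \<in> krivine_functions" and "0 < e"
  shows "\<exists>f z. dlin_sup x y f z \<and> (\<forall>v. \<bar>h v - f v\<bar> \<le> e * (\<bar>fst v\<bar> + \<bar>snd v\<bar>))"
proof -
  define F where "F = {f. \<exists>z. dlin_sup x y f z}"
  have hom: "f (c *\<^sub>R v) = c * f v" if "f \<in> krivine_functions" "0 \<le> c" for f c v
    using that unfolding krivine_functions_def by blast
  have cont: "continuous_on S f" if "f \<in> krivine_functions" for f S
    using that by (auto simp: krivine_functions_def intro: continuous_on_subset)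
  have "\<exists>f\<in>F. \<forall>v\<in>sphere 0 1. \<bar>h v - f v\<bar> < e"
  proof (rule lattice_Stone_Weierstrass)
    show "sphere (0 :: real \<times> real) 1 \<noteq> {}"
      by (auto intro!: exI[of _ "(1, 0)"] simp: norm_prod_def)
    show "(\<lambda>v. max (f v) (g v)) \<in> F" if "f \<in> F" "g \<in> F" for f g
      using that by (auto simp: F_def intro: dlin_sup_sup)
    show "(\<lambda>v. min (f v) (g v)) \<in> F" if "f \<in> F" "g \<in> F" for f g
      using that by (auto simp: F_def intro: dlin_sup_inf)
    show "continuous_on (sphere 0 1) f" if "f \<in> F" for f
      using that by (auto simp: F_def intro: cont krivine_functions_dlin_sup)
    fix p q :: "real \<times> real"
    assume pq: "p \<in> sphere 0 1" "q \<in> sphere 0 1"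
    then have pq1: "fst p ^ 2 + snd p ^ 2 = 1" "fst q ^ 2 + snd q ^ 2 = 1"
      by (auto simp: norm_prod_def)
    let ?d = "fst p * snd q - snd p * fst q"
    show "\<exists>f\<in>F. f p = h p \<and> f q = h q"
    proof (cases "?d = 0")
      case False
      \<comment> \<open>Cramer's rule for the linear form with the values \<open>h p\<close> and
        \<open>h q\<close> at the independent vectors \<open>p\<close> and \<open>q\<close>.\<close>
      define w where "w = ((h p * snd q - h q * snd p) / ?d, (h q * fst p - h p * fst q) / ?d)"
      have w: "w \<bullet> v = ((h p * snd q - h q * snd p) * fst v + (h q * fst p - h p * fst q) * snd v) / ?d"
        for v by (simp add: w_def inner_prod_def add_divide_distrib)
      have "(h p * snd q - h q * snd p) * fst p + (h q * fst p - h p * fst q) * snd p = h p * ?d"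
        "(h p * snd q - h q * snd p) * fst q + (h q * fst p - h p * fst q) * snd q = h q * ?d"
        by algebra+
      then have "w \<bullet> p = h p" "w \<bullet> q = h q" unfolding w using False by simp_all
      then show ?thesis
        using dlin_sup_lin[of x y w] by (intro bexI[of _ "\<lambda>v. w \<bullet> v"]) (auto simp: F_def)
    next
      case True
      have pp: "p \<bullet> p = 1" using pq1 by (simp add: inner_prod_def power2_eq_square)
      \<comment> \<open>Dependent unit vectors are equal or opposite, so it suffices to prescribe
        values at \<open>p\<close> and \<open>- p\<close>.\<close>
      define t where "t = p \<bullet> q"
      have "fst q = t * fst p" "snd q = t * snd p"
        using True pq1 unfolding t_def inner_prod_def inner_real_def by algebra+
      then have q: "q = t *\<^sub>R p" by (simp add: prod_eq_iff)
      with pq have "\<bar>t\<bar> = 1" by simp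
      then have "t = 1 \<or> t = -1" by linarith
      then have "q = p \<or> q = - p" using q by auto
      \<comment> \<open>The two summands live on opposite half-planes, so the values at
        \<open>p\<close> and \<open>- p\<close> are independent of each other, as they could not be
        for a linear form.\<close>
      moreover define f where "f v = h p * max (p \<bullet> v) 0 + h (- p) * max ((- p) \<bullet> v) 0" for v
      have "f p = h p" "f (- p) = h (- p)" using pp by (simp_all add: f_def)
      moreover have "dlin_sup x y (\<lambda>v. max (w \<bullet> v) 0)
          (sup (fst w *\<^sub>R x + snd w *\<^sub>R y) 0)" for w
        using dlin_sup_scale[OF dlin_sup_fst, of x y 0] by (intro dlin_sup_sup dlin_sup_lin) simp
      from dlin_sup_add[OF this[THEN dlin_sup_scale] this[THEN dlin_sup_scale]]
      have "f \<in> F" unfolding F_def f_def by blast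
      ultimately show ?thesis by metis
    qed
  qed (use \<open>0 < e\<close> in \<open>auto intro: cont h\<close>)
  then obtain f z where f: "dlin_sup x y f z" "\<And>v. norm v = 1 \<Longrightarrow> \<bar>h v - f v\<bar> < e"
    by (auto simp: F_def)
  have "\<bar>h v - f v\<bar> \<le> e * (\<bar>fst v\<bar> + \<bar>snd v\<bar>)" for v
  proof (cases "v = 0")
    case True
    have "h (0 *\<^sub>R v) = 0" "f (0 *\<^sub>R v) = 0"
      using hom[OF h, of 0] hom[OF krivine_functions_dlin_sup[OF f(1)], of 0] by auto
    then show ?thesis using True by simp
  next
    case False
    define u where "u = v /\<^sub>R norm v"
    have v: "v = norm v *\<^sub>R u" and u: "norm u = 1" using False by (auto simp: u_def)
    have "\<bar>h v - f v\<bar> = norm v * \<bar>h u - f u\<bar>"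
      using hom[OF h, of "norm v" u] hom[OF krivine_functions_dlin_sup[OF f(1)], of "norm v" u] v
      by (simp add: abs_mult flip: right_diff_distrib)
    also have "\<dots> \<le> norm v * e" using f(2)[OF u] by (intro mult_left_mono) auto
    also have "\<dots> \<le> (\<bar>fst v\<bar> + \<bar>snd v\<bar>) * e"
      using \<open>0 < e\<close> norm_Pair_le[of "fst v" "snd v"] by (intro mult_right_mono) auto
    finally show ?thesis by (simp add: mult.commute)
  qed
  then show ?thesis using f(1) by blast
qed

text \<open>The graph of the Krivine calculus, obtained from the graph \<open>dlin_sup\<close> on differences of maxima
  of linear forms by closure in the order unit norm of \<open>\<bar>x\<bar> + \<bar>y\<bar>\<close>.\<close>

definition krivine_rel ::
    "'a::banach_lattice \<Rightarrow> 'a \<Rightarrow> (real \<times> real \<Rightarrow> real) \<Rightarrow> 'a \<Rightarrow> bool"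
  where "krivine_rel x y h z \<longleftrightarrow> (\<forall>e>0. \<exists>f w. dlin_sup x y f w \<and>
    (\<forall>v. \<bar>h v - f v\<bar> \<le> e * (\<bar>fst v\<bar> + \<bar>snd v\<bar>)) \<and> \<bar>z - w\<bar> \<le> e *\<^sub>R (\<bar>x\<bar> + \<bar>y\<bar>))"

lemma krivine_relE:
  assumes "krivine_rel x y h z" "0 < e"
  obtains f w where "dlin_sup x y f w" "\<And>v. h v \<le> f v + e * (\<bar>fst v\<bar> + \<bar>snd v\<bar>)"
    "\<And>v. f v \<le> h v + e * (\<bar>fst v\<bar> + \<bar>snd v\<bar>)"
    "z \<le> w + e *\<^sub>R (\<bar>x\<bar> + \<bar>y\<bar>)" "w \<le> z + e *\<^sub>R (\<bar>x\<bar> + \<bar>y\<bar>)"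
proof -
  obtain f w where *: "dlin_sup x y f w" "\<And>v. \<bar>h v - f v\<bar> \<le> e * (\<bar>fst v\<bar> + \<bar>snd v\<bar>)"
    "\<bar>z - w\<bar> \<le> e *\<^sub>R (\<bar>x\<bar> + \<bar>y\<bar>)"
    using assms unfolding krivine_rel_def by blast
  show thesis
  proof (rule that[OF *(1)])
    show "h v \<le> f v + e * (\<bar>fst v\<bar> + \<bar>snd v\<bar>)" "f v \<le> h v + e * (\<bar>fst v\<bar> + \<bar>snd v\<bar>)" for v
      using *(2)[of v] by linarith+
    show "z \<le> w + e *\<^sub>R (\<bar>x\<bar> + \<bar>y\<bar>)" "w \<le> z + e *\<^sub>R (\<bar>x\<bar> + \<bar>y\<bar>)"
      using order_trans[OF abs_ge_self *(3)] order_trans[OF abs_ge_minus_self *(3)]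
      by (simp_all add: algebra_simps)
  qed
qed

lemma krivine_relI:
  assumes "\<And>e. 0 < e \<Longrightarrow> \<exists>f w. dlin_sup x y f w \<and>
    (\<forall>v. h v \<le> f v + e * (\<bar>fst v\<bar> + \<bar>snd v\<bar>) \<and> f v \<le> h v + e * (\<bar>fst v\<bar> + \<bar>snd v\<bar>)) \<and>
    z \<le> w + e *\<^sub>R (\<bar>x\<bar> + \<bar>y\<bar>) \<and> w \<le> z + e *\<^sub>R (\<bar>x\<bar> + \<bar>y\<bar>)"
  shows "krivine_rel x y h z"
  unfolding krivine_rel_def
proof (intro allI impI)
  fix e :: real assume "0 < e"
  then obtain f w where *: "dlin_sup x y f w"
    "\<And>v. h v \<le> f v + e * (\<bar>fst v\<bar> + \<bar>snd v\<bar>)" "\<And>v. f v \<le> h v + e * (\<bar>fst v\<bar> + \<bar>snd v\<bar>)"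
    "z \<le> w + e *\<^sub>R (\<bar>x\<bar> + \<bar>y\<bar>)" "w \<le> z + e *\<^sub>R (\<bar>x\<bar> + \<bar>y\<bar>)"
    using assms by blast
  have "\<bar>z - w\<bar> \<le> e *\<^sub>R (\<bar>x\<bar> + \<bar>y\<bar>)"
    using *(4,5) by (intro abs_leI) (simp_all add: algebra_simps)
  moreover have "\<bar>h v - f v\<bar> \<le> e * (\<bar>fst v\<bar> + \<bar>snd v\<bar>)" for v
    using *(2,3)[of v] by linarith
  ultimately show "\<exists>f w. dlin_sup x y f w \<and> (\<forall>v. \<bar>h v - f v\<bar> \<le> e * (\<bar>fst v\<bar> + \<bar>snd v\<bar>)) \<and>
      \<bar>z - w\<bar> \<le> e *\<^sub>R (\<bar>x\<bar> + \<bar>y\<bar>)"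
    using *(1) by blast
qed

lemma krivine_rel_dlin_sup: "dlin_sup x y f z \<Longrightarrow> krivine_rel x y f z"
  unfolding krivine_rel_def by (force intro: exI[of _ f] exI[of _ z] scaleR_nonneg_nonneg)

text \<open>Two approximants of \<open>h\<close> with error \<open>e / 4\<close> differ by at most
  \<open>e / 2\<close> as functions, hence as elements by \<open>dlin_sup_le_add\<close>. The errors
  against \<open>z\<close> and \<open>w\<close> add \<open>e / 4\<close> each, and \<open>e\<close>
  is arbitrary.\<close>

lemma krivine_rel_unique:
  assumes "krivine_rel x y h z" "krivine_rel x y h w"
  shows "z = w"
proof -
  have *: "z \<le> w" if z: "krivine_rel x y h z" and w: "krivine_rel x y h w" for z w
  proof (rule le_if_le_add_scaleR)
    fix e :: real assume "0 < e"
    then have e: "0 < e / 4" by simp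
    let ?N = "\<lambda>v. \<bar>fst v\<bar> + \<bar>snd v\<bar>" and ?u = "\<bar>x\<bar> + \<bar>y\<bar>"
    obtain f z' where f: "dlin_sup x y f z'" "\<And>v. f v \<le> h v + e / 4 * ?N v" "z \<le> z' + (e / 4) *\<^sub>R ?u"
      using krivine_relE[OF z e] by metis
    obtain g w' where g: "dlin_sup x y g w'" "\<And>v. h v \<le> g v + e / 4 * ?N v" "w' \<le> w + (e / 4) *\<^sub>R ?u"
      using krivine_relE[OF w e] by metis
    have "f v \<le> g v + e / 2 * ?N v" for v
      using f(2)[of v] g(2)[of v] by (simp add: field_simps)
    from dlin_sup_le_add[OF f(1) g(1) this]
    have "z \<le> (w' + (e / 2) *\<^sub>R ?u) + (e / 4) *\<^sub>R ?u"
      using f(3) by (meson add_right_mono order_trans)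
    also have "\<dots> \<le> ((w + (e / 4) *\<^sub>R ?u) + (e / 2) *\<^sub>R ?u) + (e / 4) *\<^sub>R ?u"
      using g(3) by (intro add_right_mono)
    also have "\<dots> = w + (e / 4 + e / 2 + e / 4) *\<^sub>R ?u"
      by (simp only: scaleR_add_left add.assoc)
    finally show "z \<le> w + e *\<^sub>R ?u" by simp
  qed
  show ?thesis using *[of z w] *[of w z] assms by (intro antisym)
qed

text \<open>Approximants with errors \<open>e n\<close> tending to 0 are Cauchy with respect to the
  order unit \<open>\<bar>x\<bar> + \<bar>y\<bar>\<close>, hence in norm. Completeness gives a
  limit, and closedness of the cone passes the order estimates on to it.\<close>

lemma krivine_rel_exists:
  assumes h: "h \<in> krivine_functions"
  shows "\<exists>z. krivine_rel x y h z"
proof -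
  let ?N = "\<lambda>v. \<bar>fst v\<bar> + \<bar>snd v\<bar>" and ?u = "\<bar>x\<bar> + \<bar>y\<bar>"
  define e where "e n = inverse (real (Suc n))" for n
  have e: "0 < e n" for n by (simp add: e_def)
  have e0: "e \<longlonglongrightarrow> 0" unfolding e_def by (rule LIMSEQ_inverse_real_of_nat)
  obtain f s where fs: "\<And>n. dlin_sup x y (f n) (s n)" "\<And>n v. \<bar>h v - f n v\<bar> \<le> e n * ?N v"
    using dlin_sup_dense[OF h e, of x y] by metis
  have le: "s m \<le> s n + (e m + e n) *\<^sub>R ?u" for m n
  proof (rule dlin_sup_le_add[OF fs(1) fs(1)])
    show "f m v \<le> f n v + (e m + e n) * ?N v" for v
      using fs(2)[of v m] fs(2)[of v n] unfolding distrib_right[of "e m"] by linarith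
  qed
  have ndiff: "norm (s m - s n) \<le> (e m + e n) * norm ?u" for m n
  proof -
    have "\<bar>s m - s n\<bar> \<le> (e m + e n) *\<^sub>R ?u"
      using le[of m n] le[of n m] by (intro abs_leI) (simp_all add: algebra_simps)
    then have "norm (s m - s n) \<le> norm ((e m + e n) *\<^sub>R ?u)"
      by (intro norm_mono_abs) (meson abs_ge_self order_trans)
    then show ?thesis using e[of m] e[of n] by simp
  qed
  have "Cauchy s"
  proof (rule metric_CauchyI)
    fix r :: real assume "0 < r"
    have "(\<lambda>n. e n * norm ?u) \<longlonglongrightarrow> 0 * norm ?u"
      by (intro tendsto_intros e0)
    then have "\<forall>\<^sub>F n in sequentially. e n * norm ?u < r / 2"
      using \<open>0 < r\<close> by (intro order_tendstoD(2)[where y = 0]) auto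
    then obtain M where M: "\<And>n. n \<ge> M \<Longrightarrow> e n * norm ?u < r / 2"
      by (auto simp: eventually_sequentially)
    have "dist (s m) (s n) < r" if "m \<ge> M" "n \<ge> M" for m n
      using ndiff[of m n] M[OF that(1)] M[OF that(2)] by (simp add: dist_norm distrib_right)
    then show "\<exists>M. \<forall>m\<ge>M. \<forall>n\<ge>M. dist (s m) (s n) < r" by blast
  qed
  then obtain l where l: "s \<longlonglongrightarrow> l"
    using Cauchy_convergent convergent_def by blast
  have ul: "l \<le> s n + e n *\<^sub>R ?u" for n
  proof -
    have "(\<lambda>m. s n + (e m + e n) *\<^sub>R ?u - s m) \<longlonglongrightarrow> s n + (0 + e n) *\<^sub>R ?u - l"
      by (intro tendsto_intros l e0)
    from tendsto_nonneg_lattice[OF this] le show ?thesis by simp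
  qed
  have ll: "s n \<le> l + e n *\<^sub>R ?u" for n
  proof -
    have "(\<lambda>m. s m + (e n + e m) *\<^sub>R ?u - s n) \<longlonglongrightarrow> l + (e n + 0) *\<^sub>R ?u - s n"
      by (intro tendsto_intros l e0)
    from tendsto_nonneg_lattice[OF this] le show ?thesis by simp
  qed
  have "krivine_rel x y h l"
    unfolding krivine_rel_def
  proof (intro allI impI)
    fix r :: real assume "0 < r"
    then obtain n where n: "e n < r" unfolding e_def using reals_Archimedean by blast
    have "\<bar>l - s n\<bar> \<le> e n *\<^sub>R ?u"
      using ul[of n] ll[of n] by (intro abs_leI) (simp_all add: algebra_simps)
    also have "\<dots> \<le> r *\<^sub>R ?u" using n by (intro scaleR_right_mono) auto
    finally have "\<bar>l - s n\<bar> \<le> r *\<^sub>R ?u" .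
    moreover have "\<bar>h v - f n v\<bar> \<le> r * ?N v" for v
      using fs(2)[of v n] mult_right_mono[of "e n" r "?N v"] n by simp
    ultimately show "\<exists>f w. dlin_sup x y f w \<and> (\<forall>v. \<bar>h v - f v\<bar> \<le> r * ?N v) \<and> \<bar>l - w\<bar> \<le> r *\<^sub>R ?u"
      using fs(1) by blast
  qed
  then show ?thesis ..
qed

lemma krivine_rel_add:
  assumes "krivine_rel x y h z" "krivine_rel x y k w"
  shows "krivine_rel x y (\<lambda>v. h v + k v) (z + w)"
proof (rule krivine_relI)
  fix e :: real assume "0 < e"
  then have e: "0 < e / 2" by simp
  let ?N = "\<lambda>v. \<bar>fst v\<bar> + \<bar>snd v\<bar>" and ?u = "\<bar>x\<bar> + \<bar>y\<bar>"
  have N: "e / 2 * ?N v + e / 2 * ?N v = e * ?N v" for v by (simp add: field_simps)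
  have u: "(e / 2) *\<^sub>R ?u + (e / 2) *\<^sub>R ?u = e *\<^sub>R ?u" by (simp only: flip: scaleR_add_left) simp
  obtain f z' where f: "dlin_sup x y f z'" "\<And>v. h v \<le> f v + e / 2 * ?N v"
    "\<And>v. f v \<le> h v + e / 2 * ?N v" "z \<le> z' + (e / 2) *\<^sub>R ?u" "z' \<le> z + (e / 2) *\<^sub>R ?u"
    using krivine_relE[OF assms(1) e] by metis
  obtain g w' where g: "dlin_sup x y g w'" "\<And>v. k v \<le> g v + e / 2 * ?N v"
    "\<And>v. g v \<le> k v + e / 2 * ?N v" "w \<le> w' + (e / 2) *\<^sub>R ?u" "w' \<le> w + (e / 2) *\<^sub>R ?u"
    using krivine_relE[OF assms(2) e] by metis
  have comb: "a + b \<le> (c + d) + (r + s)" if "a \<le> c + r" "b \<le> d + s"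
    for a b c d r s :: "'c::ordered_ab_group_add"
    using add_mono[OF that] by (simp add: algebra_simps)
  show "\<exists>f w'. dlin_sup x y f w' \<and> (\<forall>v. h v + k v \<le> f v + e * ?N v \<and> f v \<le> h v + k v + e * ?N v) \<and>
      z + w \<le> w' + e *\<^sub>R ?u \<and> w' \<le> z + w + e *\<^sub>R ?u"
    unfolding N[symmetric] u[symmetric]
    by (rule exI[of _ "\<lambda>v. f v + g v"], rule exI[of _ "z' + w'"])
      (intro conjI allI comb dlin_sup_add f g)
qed

lemma krivine_rel_scale:
  assumes "krivine_rel x y h z"
  shows "krivine_rel x y (\<lambda>v. c * h v) (c *\<^sub>R z)"
  unfolding krivine_rel_def
proof (intro allI impI)
  fix e :: real assume "0 < e"
  let ?N = "\<lambda>v. \<bar>fst v\<bar> + \<bar>snd v\<bar>" and ?u = "\<bar>x\<bar> + \<bar>y\<bar>"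
  \<comment> \<open>The error for \<open>h\<close> is multiplied by \<open>\<bar>c\<bar>\<close>;
    the \<open>+ 1\<close> covers \<open>c = 0\<close>.\<close>
  define d where "d = e / (\<bar>c\<bar> + 1)"
  have "0 < d" using \<open>0 < e\<close> by (simp add: d_def)
  have cd: "\<bar>c\<bar> * d \<le> e" using \<open>0 < e\<close> by (simp add: d_def field_simps)
  obtain f w where f: "dlin_sup x y f w" "\<And>v. \<bar>h v - f v\<bar> \<le> d * ?N v" "\<bar>z - w\<bar> \<le> d *\<^sub>R ?u"
    using assms \<open>0 < d\<close> unfolding krivine_rel_def by blast
  have "\<bar>c * h v - c * f v\<bar> \<le> e * ?N v" for v
  proof -
    have "\<bar>c * h v - c * f v\<bar> = \<bar>c\<bar> * \<bar>h v - f v\<bar>" by (simp add: abs_mult flip: right_diff_distrib)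
    also have "\<dots> \<le> \<bar>c\<bar> * (d * ?N v)" using f(2) by (intro mult_left_mono) auto
    also have "\<dots> = (\<bar>c\<bar> * d) * ?N v" by simp
    also have "\<dots> \<le> e * ?N v" using cd by (intro mult_right_mono) auto
    finally show ?thesis .
  qed
  moreover have "\<bar>c *\<^sub>R z - c *\<^sub>R w\<bar> \<le> e *\<^sub>R ?u"
  proof -
    have "c *\<^sub>R (z - w) \<le> \<bar>c\<bar> *\<^sub>R \<bar>z - w\<bar>" "(- c) *\<^sub>R (z - w) \<le> \<bar>c\<bar> *\<^sub>R \<bar>z - w\<bar>"
      by (rule scaleR_le_abs, simp)+
    then have "\<bar>c *\<^sub>R z - c *\<^sub>R w\<bar> \<le> \<bar>c\<bar> *\<^sub>R \<bar>z - w\<bar>"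
      by (intro abs_leI) (simp_all add: scaleR_diff_right)
    also have "\<dots> \<le> \<bar>c\<bar> *\<^sub>R (d *\<^sub>R ?u)" using f(3) by (intro scaleR_left_mono) auto
    also have "\<dots> = (\<bar>c\<bar> * d) *\<^sub>R ?u" by simp
    also have "\<dots> \<le> e *\<^sub>R ?u" using cd by (intro scaleR_right_mono) auto
    finally show ?thesis .
  qed
  ultimately show "\<exists>f w. dlin_sup x y f w \<and> (\<forall>v. \<bar>c * h v - f v\<bar> \<le> e * ?N v) \<and> \<bar>c *\<^sub>R z - w\<bar> \<le> e *\<^sub>R ?u"
    using dlin_sup_scale[OF f(1), of c] by blast
qed

lemma krivine_rel_sup:
  assumes "krivine_rel x y h z" "krivine_rel x y k w"
  shows "krivine_rel x y (\<lambda>v. max (h v) (k v)) (sup z w)"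
proof (rule krivine_relI)
  fix e :: real assume e: "0 < e"
  let ?N = "\<lambda>v. \<bar>fst v\<bar> + \<bar>snd v\<bar>" and ?u = "\<bar>x\<bar> + \<bar>y\<bar>"
  obtain f z' where f: "dlin_sup x y f z'" "\<And>v. h v \<le> f v + e * ?N v"
    "\<And>v. f v \<le> h v + e * ?N v" "z \<le> z' + e *\<^sub>R ?u" "z' \<le> z + e *\<^sub>R ?u"
    using krivine_relE[OF assms(1) e] by metis
  obtain g w' where g: "dlin_sup x y g w'" "\<And>v. k v \<le> g v + e * ?N v"
    "\<And>v. g v \<le> k v + e * ?N v" "w \<le> w' + e *\<^sub>R ?u" "w' \<le> w + e *\<^sub>R ?u"
    using krivine_relE[OF assms(2) e] by metis
  have comb: "sup a b \<le> sup c d + r" if "a \<le> c + r" "b \<le> d + r" for a b c d r :: 'a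
    using sup_mono[OF that] by (simp add: add_sup_distrib_right)
  have comb': "max a b \<le> max c d + r" if "a \<le> c + r" "b \<le> d + r" for a b c d r :: real
    using that by linarith
  show "\<exists>f w'. dlin_sup x y f w' \<and>
      (\<forall>v. max (h v) (k v) \<le> f v + e * ?N v \<and> f v \<le> max (h v) (k v) + e * ?N v) \<and>
      sup z w \<le> w' + e *\<^sub>R ?u \<and> w' \<le> sup z w + e *\<^sub>R ?u"
    by (rule exI[of _ "\<lambda>v. max (f v) (g v)"], rule exI[of _ "sup z' w'"])
      (intro conjI allI comb comb' dlin_sup_sup f g)
qed

lemma krivine_rel_inf:
  assumes "krivine_rel x y h z" "krivine_rel x y k w"
  shows "krivine_rel x y (\<lambda>v. min (h v) (k v)) (inf z w)"
  using krivine_rel_scale[OF krivine_rel_sup[OF assms[THEN krivine_rel_scale[where c = "-1"]]], of "-1"]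
  by (simp only: inf_eq_neg_sup[of z] minus_max_eq_min minus_minus mult_minus1 scaleR_minus1_left)

section \<open>Existence and uniqueness of the Krivine homomorphism\<close>

lemma krivine_hom_exists: "\<exists>\<tau>. krivine_hom x y \<tau>"
proof -
  \<comment> \<open>The relation is total on \<open>krivine_functions\<close>, so a value can be
    chosen; \<open>krivine_rel_unique\<close> then turns each closure rule of the relation into an
    equation for \<open>\<tau>\<close>.\<close>
  define \<tau> where "\<tau> h = (SOME z. krivine_rel x y h z)" for h
  have \<tau>: "krivine_rel x y h (\<tau> h)" if "h \<in> krivine_functions" for h
    unfolding \<tau>_def using krivine_rel_exists[OF that] by (rule someI_ex)
  have eq: "\<tau> h = z" if h: "krivine_rel x y h z" for h z
    unfolding \<tau>_def using h krivine_rel_unique[OF _ h] by (rule some_equality)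
  show ?thesis
    unfolding krivine_hom_def
    by (intro exI[of _ \<tau>] conjI ballI allI eq krivine_rel_add krivine_rel_sup krivine_rel_inf
        krivine_rel_scale \<tau> krivine_rel_dlin_sup dlin_sup_fst dlin_sup_snd)
qed

lemma krivine_hom_mono:
  assumes "krivine_hom x y \<tau>" "h \<in> krivine_functions" "k \<in> krivine_functions" "\<And>v. h v \<le> k v"
  shows "\<tau> h \<le> \<tau> k"
proof -
  have "(\<lambda>v. max (h v) (k v)) = k" using assms(4) by (simp add: fun_eq_iff max_absorb2)
  then have "\<tau> k = sup (\<tau> h) (\<tau> k)" using assms(1-3) unfolding krivine_hom_def by metis
  then show ?thesis by (metis sup_ge1)
qed

lemma krivine_hom_lin_sup:
  assumes "krivine_hom x y \<tau>" "lin_sup x y f z"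
  shows "\<tau> f = z"
  using assms(2)
proof induction
  case (lin w)
  have "(\<lambda>v. w \<bullet> v) = (\<lambda>v. fst w * fst v + snd w * snd v)"
    by (simp add: inner_prod_def)
  then show ?case
    using assms(1) krivine_functions_scale[OF krivine_functions_fst, of "fst w"]
      krivine_functions_scale[OF krivine_functions_snd, of "snd w"]
      krivine_functions_fst krivine_functions_snd
    by (simp add: krivine_hom_def)
next
  case (sup f z g w)
  then show ?case
    using assms(1) krivine_functions_lin_sup[OF sup.hyps(1)] krivine_functions_lin_sup[OF sup.hyps(2)]
    by (simp add: krivine_hom_def)
qed

lemma krivine_hom_dlin_sup:
  assumes \<tau>: "krivine_hom x y \<tau>" and "dlin_sup x y f z"
  shows "\<tau> f = z"
proof -
  obtain f1 z1 f2 z2 where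
    *: "lin_sup x y f1 z1" "lin_sup x y f2 z2" "f = (\<lambda>v. f1 v - f2 v)" "z = z1 - z2"
    using assms(2) unfolding dlin_sup_def by blast
  note mem = krivine_functions_dlin_sup[OF assms(2)] *(2)[THEN krivine_functions_lin_sup]
  have "\<tau> (\<lambda>v. f v + f2 v) = \<tau> f + \<tau> f2"
    using \<tau> mem by (simp add: krivine_hom_def)
  then show ?thesis
    using krivine_hom_lin_sup[OF \<tau> *(1)] krivine_hom_lin_sup[OF \<tau> *(2)] *(3,4) by simp
qed

text \<open>The source of uniqueness. On \<open>dlin_sup\<close> functions the value of
  \<open>\<tau>\<close> is determined algebraically. Monotonicity, a consequence of preserving
  maxima, plays the part of continuity: it carries the taxicab estimate between \<open>h\<close> and
  an approximant over to the values.\<close>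

lemma krivine_hom_rel:
  assumes \<tau>: "krivine_hom x y \<tau>" and h: "h \<in> krivine_functions"
  shows "krivine_rel x y h (\<tau> h)"
proof (rule krivine_relI)
  fix e :: real assume "0 < e"
  let ?N = "\<lambda>v. \<bar>fst v\<bar> + \<bar>snd v\<bar>" and ?u = "\<bar>x\<bar> + \<bar>y\<bar>"
  obtain f z where f: "dlin_sup x y f z" "\<And>v. \<bar>h v - f v\<bar> \<le> e * ?N v"
    using dlin_sup_dense[OF h \<open>0 < e\<close>] by blast
  note eN = dlin_sup_scale[OF dlin_sup_taxicab[of x y], of e]
  have le: "h v \<le> f v + e * ?N v" "f v \<le> h v + e * ?N v" for v
    using f(2)[of v] by linarith+
  have "\<tau> h \<le> \<tau> (\<lambda>v. f v + e * ?N v)"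
    by (rule krivine_hom_mono[OF \<tau> h krivine_functions_dlin_sup[OF dlin_sup_add[OF f(1) eN]] le(1)])
  also have "\<dots> = z + e *\<^sub>R ?u"
    by (rule krivine_hom_dlin_sup[OF \<tau> dlin_sup_add[OF f(1) eN]])
  finally have 1: "\<tau> h \<le> z + e *\<^sub>R ?u" .
  have "z = \<tau> f"
    by (rule krivine_hom_dlin_sup[OF \<tau> f(1), symmetric])
  also have "\<dots> \<le> \<tau> (\<lambda>v. h v + e * ?N v)"
    using le(2) by (intro krivine_hom_mono[OF \<tau>] krivine_functions_add h
        krivine_functions_dlin_sup[OF f(1)] krivine_functions_dlin_sup[OF eN])
  also have "\<dots> = \<tau> h + \<tau> (\<lambda>v. e * ?N v)"
    using \<tau> h krivine_functions_dlin_sup[OF eN] by (simp add: krivine_hom_def)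
  also have "\<tau> (\<lambda>v. e * ?N v) = e *\<^sub>R ?u"
    by (rule krivine_hom_dlin_sup[OF \<tau> eN])
  finally show "\<exists>f w. dlin_sup x y f w \<and> (\<forall>v. h v \<le> f v + e * ?N v \<and> f v \<le> h v + e * ?N v) \<and>
      \<tau> h \<le> w + e *\<^sub>R ?u \<and> w \<le> \<tau> h + e *\<^sub>R ?u"
    using f(1) le 1 by blast
qed

text \<open>Resolves the definite description in \<open>krivine\<close>: the values of any two
  homomorphisms at \<open>h\<close> are both related to \<open>h\<close>, hence equal.\<close>

theorem krivine_eq_hom:
  assumes "krivine_hom x y \<tau>" "h \<in> krivine_functions"
  shows "krivine h x y = \<tau> h"
  unfolding krivine_def
  by (rule the_equality) (use assms krivine_hom_rel krivine_rel_unique in blast)+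

lemma krivine_mono:
  assumes "h \<in> krivine_functions" "k \<in> krivine_functions" "\<And>v. h v \<le> k v"
  shows "krivine h x y \<le> krivine k x y"
proof -
  obtain \<tau> where \<tau>: "krivine_hom x y \<tau>" using krivine_hom_exists by blast
  show ?thesis
    unfolding krivine_eq_hom[OF \<tau> assms(1)] krivine_eq_hom[OF \<tau> assms(2)]
    by (rule krivine_hom_mono[OF \<tau> assms])
qed

lemma krivine_dlin_sup:
  assumes "dlin_sup x y f z"
  shows "krivine f x y = z"
proof -
  obtain \<tau> where \<tau>: "krivine_hom x y \<tau>" using krivine_hom_exists by blast
  show ?thesis
    using krivine_eq_hom[OF \<tau> krivine_functions_dlin_sup[OF assms]] krivine_hom_dlin_sup[OF \<tau> assms]
    by simp
qed

section \<open>Convexity and concavity estimates\<close>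

lemma lp_sum_krivine_functions:
  assumes "0 < p"
  shows "lp_sum p \<in> krivine_functions"
proof (cases "p = \<infinity>")
  case True
  then have "lp_sum p = (\<lambda>v. max \<bar>fst v\<bar> \<bar>snd v\<bar>)" by (simp add: lp_sum_def fun_eq_iff)
  then show ?thesis
    by (simp add: krivine_functions_max krivine_functions_abs krivine_functions_fst krivine_functions_snd)
next
  case False
  define r where "r = enn2real p"
  have r: "0 < r" using assms False by (simp add: r_def enn2real_positive_iff top.not_eq_extremum)
  have eq: "lp_sum p = (\<lambda>v. (\<bar>fst v\<bar> powr r + \<bar>snd v\<bar> powr r) powr (1 / r))"
    using False by (simp add: lp_sum_def r_def fun_eq_iff)
  have "(\<bar>c * s\<bar> powr r + \<bar>c * t\<bar> powr r) powr (1 / r) = c * (\<bar>s\<bar> powr r + \<bar>t\<bar> powr r) powr (1 / r)"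
    if "0 \<le> c" for c s t :: real
  proof -
    have "\<bar>c * s\<bar> powr r + \<bar>c * t\<bar> powr r = c powr r * (\<bar>s\<bar> powr r + \<bar>t\<bar> powr r)"
      using that by (simp add: abs_mult powr_mult distrib_left)
    then show ?thesis
      using r that by (simp add: powr_mult powr_powr)
  qed
  then show ?thesis
    using r unfolding eq krivine_functions_def
    by (auto intro!: continuous_intros continuous_on_powr')
qed

lemma abs_le_lp_sum:
  assumes "0 < p"
  shows "\<bar>fst v\<bar> \<le> lp_sum p v" "\<bar>snd v\<bar> \<le> lp_sum p v"
proof -
  have "\<bar>fst v\<bar> \<le> lp_sum p v \<and> \<bar>snd v\<bar> \<le> lp_sum p v"
  proof (cases "p = \<infinity>")
    case True
    then show ?thesis by (simp add: lp_sum_def)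
  next
    case False
    define r where "r = enn2real p"
    have r: "0 < r" using assms False by (simp add: r_def enn2real_positive_iff top.not_eq_extremum)
    have *: "a \<le> (a powr r + b powr r) powr (1 / r)" if "0 \<le> a" for a b :: real
    proof -
      have "(a powr r) powr (1 / r) \<le> (a powr r + b powr r) powr (1 / r)"
        using r by (intro powr_mono2) auto
      then show ?thesis using r that by (simp add: powr_powr)
    qed
    show ?thesis
      using *[of "\<bar>fst v\<bar>" "\<bar>snd v\<bar>"] *[of "\<bar>snd v\<bar>" "\<bar>fst v\<bar>"] False
      by (simp add: lp_sum_def r_def add.commute)
  qed
  then show "\<bar>fst v\<bar> \<le> lp_sum p v" "\<bar>snd v\<bar> \<le> lp_sum p v" by auto
qed

text \<open>For \<open>c\<close> equal to \<open>a\<close> or \<open>b\<close>, one factor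
  \<open>c\<close> is kept and the remaining power \<open>r - 1 \<ge> 0\<close> is enlarged from
  \<open>c\<close> to \<open>a + b\<close>. Adding the two cases gives
  \<open>a powr r + b powr r \<le> (a + b) powr r\<close>.\<close>

lemma lp_sum_le_add:
  assumes "1 \<le> q" "q < \<infinity>"
  shows "lp_sum q v \<le> \<bar>fst v\<bar> + \<bar>snd v\<bar>"
proof -
  define r where "r = enn2real q"
  have r: "1 \<le> r" using enn2real_mono[of 1 q] assms by (simp add: r_def)
  have "a powr r + b powr r \<le> (a + b) powr r" if "0 \<le> a" "0 \<le> b" for a b :: real
  proof -
    have *: "c powr r \<le> c * (a + b) powr (r - 1)" if "0 \<le> c" "c \<le> a + b" for c
    proof -
      have "c powr r = c * c powr (r - 1)"
        using that by (cases "c = 0") (simp_all add: powr_mult_base)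
      also have "\<dots> \<le> c * (a + b) powr (r - 1)"
        using that r by (intro mult_left_mono powr_mono2) auto
      finally show ?thesis .
    qed
    have "a powr r + b powr r \<le> (a + b) * (a + b) powr (r - 1)"
      using *[of a] *[of b] that by (simp add: distrib_right)
    then show ?thesis using that by (simp add: powr_mult_base)
  qed
  then have "(\<bar>fst v\<bar> powr r + \<bar>snd v\<bar> powr r) powr (1 / r) \<le> ((\<bar>fst v\<bar> + \<bar>snd v\<bar>) powr r) powr (1 / r)"
    using r by (intro powr_mono2) auto
  then show ?thesis
    using assms(2) r by (simp add: lp_sum_def r_def powr_powr)
qed

section \<open>Norms of suprema and sums of positive elements\<close>

lemma modulus_Complexification_0: "modulus (Complexification x 0) = \<bar>x\<bar>"
  using abs_cRe_le_modulus[of "Complexification x 0"] modulus_le_add[of "Complexification x 0"]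
  by (intro antisym) simp_all

lemma norm_Complexification_0: "norm (Complexification x 0) = norm x"
  by (simp add: norm_complexification_def modulus_Complexification_0)

text \<open>The Krivine element dominates both \<open>x\<close> and \<open>y\<close>, hence their
  supremum. From here on the functional calculus enters only through this bound and
  \<open>q_concave_le_norm_add\<close>.\<close>

lemma p_convex_norm_sup_le:
  fixes x y :: "'a::banach_lattice"
  assumes "p_convex TYPE('a) p" "0 < p" "0 \<le> x" "0 \<le> y"
  shows "norm (sup x y) \<le> lp_sum p (norm x, norm y)"
proof -
  have "x \<le> krivine (lp_sum p) x y" "y \<le> krivine (lp_sum p) x y"
    using krivine_mono[of fst "lp_sum p" x y] krivine_mono[of snd "lp_sum p" x y]
      abs_le_lp_sum[OF assms(2)] krivine_dlin_sup[OF dlin_sup_fst] krivine_dlin_sup[OF dlin_sup_snd]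
      krivine_functions_fst krivine_functions_snd lp_sum_krivine_functions[OF assms(2)]
    by (metis abs_le_D1)+
  then have "norm (sup x y) \<le> norm (krivine (lp_sum p) x y)"
    using assms(3) by (intro norm_mono_nonneg) (auto intro: le_supI1)
  also have "\<dots> \<le> lp_sum p (norm x, norm y)"
    using assms(1)[unfolded p_convex_def, rule_format, of "Complexification x 0" "Complexification y 0"]
      assms(3,4) by (simp add: modulus_Complexification_0 norm_Complexification_0)
  finally show ?thesis .
qed

text \<open>\<open>lp_sum q\<close> lies between the first coordinate and the taxicab norm. The
  upper bound gives the comparison with \<open>x + y\<close>; the lower one makes the Krivine
  element positive, as norm monotonicity demands.\<close>

lemma q_concave_le_norm_add:
  fixes x y :: "'a::banach_lattice"
  assumes "q_concave TYPE('a) q" "1 \<le> q" "q < \<infinity>" "0 \<le> x" "0 \<le> y"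
  shows "lp_sum q (norm x, norm y) \<le> norm (x + y)"
proof -
  have "0 < q" using assms(2) by (rule less_le_trans[OF zero_less_one])
  note mem = lp_sum_krivine_functions[OF this]
  have "fst v \<le> lp_sum q v" for v using abs_le_lp_sum(1)[OF \<open>0 < q\<close>, of v] by simp
  from krivine_mono[OF krivine_functions_fst mem this, of x y]
  have "0 \<le> krivine (lp_sum q) x y"
    using assms(4) krivine_dlin_sup[OF dlin_sup_fst, of x y] by simp
  moreover have "krivine (lp_sum q) x y \<le> x + y"
    using krivine_mono[OF mem krivine_functions_dlin_sup[OF dlin_sup_taxicab] lp_sum_le_add[OF assms(2,3)], of x y]
      krivine_dlin_sup[OF dlin_sup_taxicab, of x y] assms(4,5) by simp
  ultimately have "norm (krivine (lp_sum q) x y) \<le> norm (x + y)"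
    by (rule norm_mono_nonneg)
  then show ?thesis
    using assms(1)[unfolded q_concave_def, rule_format, of "Complexification x 0" "Complexification y 0"]
      assms(4,5) by (simp add: modulus_Complexification_0 norm_Complexification_0)
qed

text \<open>\<open>g\<close> is the supremum, built up one term at a time. For finite
  \<open>p\<close> the induction runs on \<open>norm g powr r\<close>, to which each term adds at
  most \<open>B powr r\<close>; the root is taken once at the end.\<close>

lemma p_convex_upper_estimate:
  fixes f :: "nat \<Rightarrow> 'a::banach_lattice"
  assumes "p_convex TYPE('a) p" "0 < p" "0 < w"
    and f: "\<And>m. m < w \<Longrightarrow> 0 \<le> f m \<and> norm (f m) \<le> B"
  shows "\<exists>g\<ge>0. (\<forall>m<w. f m \<le> g) \<and> norm g \<le> real w powr enn2real (1 / p) * B"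
proof (cases "p = \<infinity>")
  case True
  have "\<exists>g\<ge>0. (\<forall>m<w. f m \<le> g) \<and> norm g \<le> B"
    using \<open>0 < w\<close> f
  proof (induction w rule: nat_induct_non_zero)
    case 1
    then show ?case by (intro exI[of _ "f 0"]) auto
  next
    case (Suc n)
    then obtain g where g: "0 \<le> g" "\<forall>m<n. f m \<le> g" "norm g \<le> B" by force
    have "norm (sup g (f n)) \<le> lp_sum p (norm g, norm (f n))"
      using p_convex_norm_sup_le[OF assms(1,2)] g Suc.prems by simp
    also have "\<dots> \<le> B" using g(3) Suc.prems[of n] True by (simp add: lp_sum_def)
    finally show ?case
      using g by (intro exI[of _ "sup g (f n)"]) (auto simp: less_Suc_eq intro: le_supI1)
  qed
  \<comment> \<open>Here \<open>1 / p = 0\<close>, and \<open>real w powr 0 = 1\<close> because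
    \<open>w\<close> is positive.\<close>
  then show ?thesis using \<open>0 < w\<close> True by simp
next
  case False
  define r where "r = enn2real p"
  have r: "0 < r" using assms(2) False by (simp add: r_def enn2real_positive_iff top.not_eq_extremum)
  have B: "0 \<le> B" using f[of 0] \<open>0 < w\<close> norm_ge_zero order_trans by blast
  have "\<exists>g\<ge>0. (\<forall>m<w. f m \<le> g) \<and> norm g powr r \<le> real w * B powr r"
    using \<open>0 < w\<close> f
  proof (induction w rule: nat_induct_non_zero)
    case 1
    then show ?case using r by (intro exI[of _ "f 0"]) (auto intro: powr_mono2)
  next
    case (Suc n)
    then obtain g where g: "0 \<le> g" "\<forall>m<n. f m \<le> g" "norm g powr r \<le> real n * B powr r" by force
    have "norm (sup g (f n)) \<le> lp_sum p (norm g, norm (f n))"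
      using p_convex_norm_sup_le[OF assms(1,2)] g Suc.prems by simp
    then have "norm (sup g (f n)) powr r \<le> lp_sum p (norm g, norm (f n)) powr r"
      using r by (intro powr_mono2) auto
    also have "\<dots> = norm g powr r + norm (f n) powr r"
      using False r by (simp add: lp_sum_def powr_powr flip: r_def)
    also have "\<dots> \<le> real n * B powr r + B powr r"
      using g(3) Suc.prems[of n] r by (intro add_mono powr_mono2) auto
    finally have "norm (sup g (f n)) powr r \<le> real (Suc n) * B powr r"
      by (simp add: algebra_simps)
    then show ?case
      using g by (intro exI[of _ "sup g (f n)"]) (auto simp: less_Suc_eq intro: le_supI1)
  qed
  then obtain g where g: "0 \<le> g" "\<forall>m<w. f m \<le> g" "norm g powr r \<le> real w * B powr r" by blast
  have "(norm g powr r) powr (1 / r) \<le> (real w * B powr r) powr (1 / r)"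
    using g(3) r by (intro powr_mono2) auto
  then have "norm g \<le> real w powr (1 / r) * B"
    using r B by (simp add: powr_powr powr_mult)
  moreover have "enn2real (1 / p) = 1 / r"
    using False assms(2) by (cases p) (auto simp: r_def divide_ennreal simp flip: ennreal_1)
  ultimately show ?thesis using g by auto
qed

text \<open>By induction the \<open>q\<close>-th powers of the norms add up to at most that of the
  sum, so \<open>real w powr (1 / r) * b\<close> bounds the norm of the sum from below. Multiplying
  by \<open>real w powr (1 - 1 / r)\<close> brings in the conjugate exponent.\<close>

lemma q_concave_lower_estimate:
  fixes f :: "nat \<Rightarrow> 'a::banach_lattice"
  assumes "q_concave TYPE('a) q" "1 \<le> q" "q < \<infinity>" "0 < w" "0 \<le> b"
    and f: "\<And>m. m < w \<Longrightarrow> 0 \<le> f m \<and> b \<le> norm (f m)"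
  shows "real w * b \<le> real w powr (1 - 1 / enn2real q) * norm (\<Sum>m<w. f m)"
proof -
  define r where "r = enn2real q"
  have r: "1 \<le> r" using enn2real_mono[of 1 q] assms by (simp add: r_def)
  have "real w * b powr r \<le> norm (\<Sum>m<w. f m) powr r"
    using \<open>0 < w\<close> f
  proof (induction w rule: nat_induct_non_zero)
    case 1
    then show ?case using r \<open>0 \<le> b\<close> by (auto intro: powr_mono2)
  next
    case (Suc n)
    have "real (Suc n) * b powr r \<le> norm (\<Sum>m<n. f m) powr r + norm (f n) powr r"
      using Suc.IH Suc.prems r \<open>0 \<le> b\<close> powr_mono2[of r b "norm (f n)"]
      by (simp add: distrib_right)
    also have "\<dots> = lp_sum q (norm (\<Sum>m<n. f m), norm (f n)) powr r"
      using less_imp_neq[OF assms(3)] r by (simp add: lp_sum_def powr_powr flip: r_def)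
    also have "\<dots> \<le> norm ((\<Sum>m<n. f m) + f n) powr r"
    proof (rule powr_mono2)
      show "lp_sum q (norm (\<Sum>m<n. f m), norm (f n)) \<le> norm ((\<Sum>m<n. f m) + f n)"
        using Suc.prems by (intro q_concave_le_norm_add[OF assms(1-3)] sum_nonneg) auto
    qed (use r in \<open>auto simp: lp_sum_def le_max_iff_disj\<close>)
    finally show ?case by simp
  qed
  then have "(real w * b powr r) powr (1 / r) \<le> (norm (\<Sum>m<w. f m) powr r) powr (1 / r)"
    using r by (intro powr_mono2) auto
  then have "real w powr (1 / r) * b \<le> norm (\<Sum>m<w. f m)"
    using r \<open>0 \<le> b\<close> by (simp add: powr_powr powr_mult)
  then have "real w powr (1 - 1 / r) * (real w powr (1 / r) * b)
      \<le> real w powr (1 - 1 / r) * norm (\<Sum>m<w. f m)"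
    by (intro mult_left_mono) auto
  also have "real w powr (1 - 1 / r) * (real w powr (1 / r) * b) = real w * b"
    using \<open>0 < w\<close> by (simp flip: powr_add mult.assoc)
  finally show ?thesis by (simp add: r_def)
qed

section \<open>Exponential bounds\<close>

lemma ln_add_one_ge_Pade:
  fixes y :: real
  assumes "0 \<le> y"
  shows "2 * y / (2 + y) \<le> ln (1 + y)"
proof -
  let ?g = "\<lambda>t::real. ln (1 + t) - 2 * t / (2 + t)"
  have "?g 0 \<le> ?g y"
  proof (rule DERIV_nonneg_imp_nondecreasing[OF assms], intro exI conjI)
    fix t :: real assume t: "0 \<le> t"
    show "(?g has_real_derivative (1 / (1 + t) - (2 * (2 + t) - 2 * t) / (2 + t)\<^sup>2)) (at t)"
      using t by (auto intro!: derivative_eq_intros simp: power2_eq_square)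
    have "1 / (1 + t) - (2 * (2 + t) - 2 * t) / (2 + t)\<^sup>2 = t\<^sup>2 / ((1 + t) * (2 + t)\<^sup>2)"
      using t by (simp add: divide_simps add_eq_0_iff) (simp add: power2_eq_square algebra_simps)
    then show "0 \<le> 1 / (1 + t) - (2 * (2 + t) - 2 * t) / (2 + t)\<^sup>2"
      using t by simp
  qed
  then show ?thesis by simp
qed

text \<open>Stirling's upper bound for the factorial. The induction step amounts to
  \<open>exp 1 \<le> (1 + 1 / x) powr (x + 1 / 2)\<close>, which is
  \<open>ln_add_one_ge_Pade\<close> at \<open>1 / x\<close>. The constant \<open>exp 1\<close> gives
  equality at \<open>n = 1\<close>.\<close>

lemma exp_le_fact_bound:
  assumes "1 \<le> n"
  shows "exp (real n) \<le> exp 1 * sqrt (real n) * (real n ^ n / fact n)"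
  using assms
proof (induction n rule: nat_induct_at_least)
  case (Suc n)
  define x where "x = real n"
  have x: "1 \<le> x" using Suc by (simp add: x_def)
  define L where "L = ln (1 + 1 / x)"
  have eL: "exp L = 1 + 1 / x" using x by (simp add: L_def add_pos_nonneg)
  have "(x + 1 / 2) * (2 * (1 / x) / (2 + 1 / x)) \<le> (x + 1 / 2) * L"
    unfolding L_def using x by (intro mult_left_mono ln_add_one_ge_Pade) auto
  moreover have "(x + 1 / 2) * (2 * (1 / x) / (2 + 1 / x)) = 1"
    using x by (simp add: divide_simps)
  ultimately have "exp 1 \<le> exp (x * L + L / 2)" by (simp add: algebra_simps)
  also have "\<dots> = (1 + 1 / x) ^ n * sqrt (1 + 1 / x)"
  proof -
    have "sqrt (1 + 1 / x) = exp (L / 2)"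
      by (rule real_sqrt_unique) (simp_all add: eL flip: exp_double)
    then show ?thesis by (simp add: exp_add x_def exp_of_nat_mult eL[unfolded x_def])
  qed
  finally have "exp 1 * (sqrt x * x ^ n) \<le> (1 + 1 / x) ^ n * sqrt (1 + 1 / x) * (sqrt x * x ^ n)"
    using x by (intro mult_right_mono) auto
  also have "\<dots> = ((1 + 1 / x) * x) ^ n * sqrt ((1 + 1 / x) * x)"
    by (simp add: power_mult_distrib real_sqrt_mult)
  also have "(1 + 1 / x) * x = real (Suc n)"
    using x by (simp add: x_def field_simps)
  finally have "exp 1 * (exp 1 * (sqrt x * x ^ n) / fact n)
      \<le> exp 1 * (real (Suc n) ^ n * sqrt (real (Suc n)) / fact n)"
    by (intro mult_left_mono divide_right_mono) auto
  moreover have "exp (real (Suc n)) \<le> exp 1 * (exp 1 * (sqrt x * x ^ n) / fact n)"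
    using mult_left_mono[OF Suc.IH, of "exp 1"] by (simp add: x_def exp_add mult.assoc)
  ultimately show ?case by (simp add: mult_ac del: of_nat_Suc)
qed simp

text \<open>Lowering the index from \<open>n\<close> to \<open>n - m\<close> multiplies the weight
  by the product of \<open>1 - i / n\<close> over \<open>i < m\<close>. This product is at least 1
  minus the sum of the \<open>i / n\<close>, which is the factor on the left.\<close>

lemma power_div_fact_window:
  assumes "m \<le> n" "1 \<le> n"
  shows "(1 - real m * (real m - 1) / (2 * real n)) * (real n ^ n / fact n)
    \<le> real n ^ (n - m) / fact (n - m)"
  using assms(1)
proof (induction m)
  case (Suc m)
  define j where "j = n - Suc m"
  have j: "n - m = Suc j" "real n - real m = real j + 1" using Suc.prems by (auto simp: j_def)
  let ?M = "real n ^ n / fact n"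
  have "real n ^ j / fact j = (1 - real m / real n) * (real n ^ (n - m) / fact (n - m))"
  proof -
    have "1 - real m / real n = real (Suc j) / real n"
      using j(2) assms(2) by (simp add: field_simps)
    then show ?thesis using assms(2) unfolding j(1) by simp
  qed
  also have "\<dots> \<ge> (1 - real m / real n) * ((1 - real m * (real m - 1) / (2 * real n)) * ?M)"
    using Suc assms(2) by (intro mult_left_mono) auto
  finally have "(1 - real m / real n) * (1 - real m * (real m - 1) / (2 * real n)) * ?M \<le> real n ^ j / fact j"
    by (simp only: mult.assoc)
  moreover have "1 - real (Suc m) * (real (Suc m) - 1) / (2 * real n)
      \<le> (1 - real m / real n) * (1 - real m * (real m - 1) / (2 * real n))"
  proof -
    have "(1 - real m / real n) * (1 - real m * (real m - 1) / (2 * real n)) =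
      1 - real (Suc m) * (real (Suc m) - 1) / (2 * real n) + real m * (real m * (real m - 1)) / (2 * real n * real n)"
      using assms(2) by (simp add: field_simps power2_eq_square)
    moreover have "0 \<le> real m * (real m * (real m - 1))" by (cases m) auto
    ultimately show ?thesis by simp
  qed
  then have "(1 - real (Suc m) * (real (Suc m) - 1) / (2 * real n)) * ?M
     \<le> (1 - real m / real n) * (1 - real m * (real m - 1) / (2 * real n)) * ?M"
    by (intro mult_right_mono) auto
  ultimately show ?case unfolding j_def[symmetric] by linarith
qed simp

text \<open>For \<open>m\<close> up to the square root of \<open>n\<close> the factor in
  \<open>power_div_fact_window\<close> is at least \<open>1 / 2\<close>; hence the additional 2
  compared with \<open>exp_le_fact_bound\<close>.\<close>

lemma exp_le_window:
  assumes "1 \<le> n" "m ^ 2 \<le> n"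
  shows "exp (real n) \<le> 2 * exp 1 * sqrt (real n) * (real n ^ (n - m) / fact (n - m))"
proof -
  have "m \<le> n" using assms(2) by (metis le_square order_trans power2_eq_square)
  have "real m * real m \<le> real n"
    using assms(2) by (metis of_nat_le_iff of_nat_mult power2_eq_square)
  moreover have "real m * (real m - 1) \<le> real m * real m" by (intro mult_left_mono) auto
  ultimately have "real m * (real m - 1) / (2 * real n) \<le> 1 / 2"
    using assms(1) by (simp add: field_simps)
  then have "1 / 2 * (real n ^ n / fact n) \<le> (1 - real m * (real m - 1) / (2 * real n)) * (real n ^ n / fact n)"
    by (intro mult_right_mono) auto
  then have "real n ^ n / fact n \<le> 2 * (real n ^ (n - m) / fact (n - m))"
    using power_div_fact_window[OF \<open>m \<le> n\<close> assms(1)] by linarith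
  then have "exp 1 * sqrt (real n) * (real n ^ n / fact n)
      \<le> exp 1 * sqrt (real n) * (2 * (real n ^ (n - m) / fact (n - m)))"
    by (intro mult_left_mono) auto
  with exp_le_fact_bound[OF assms(1)] show ?thesis by (simp add: mult.assoc mult.left_commute)
qed

lemma funpow_nonneg:
  fixes A :: "'a::{zero,ord} \<Rightarrow> 'a"
  assumes "\<And>x. 0 \<le> x \<Longrightarrow> 0 \<le> A x" "0 \<le> x"
  shows "0 \<le> (A ^^ n) x"
  using assms(2) by (induction n) (auto intro: assms(1))

lemma window_sum_bound:
  fixes A :: "'a::banach_lattice \<Rightarrow> 'a"
  assumes pos: "\<And>x. 0 \<le> x \<Longrightarrow> 0 \<le> A x"
    and exp: "\<And>N t x. 0 < t \<Longrightarrow> 0 \<le> x \<Longrightarrow>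
      norm (\<Sum>k\<le>N. (t ^ k / fact k) *\<^sub>R (A ^^ k) x) \<le> K * exp t * norm x"
    and "1 \<le> n" "0 \<le> K" "0 \<le> x"
  shows "norm (\<Sum>m<floor_sqrt n. (A ^^ (n - m)) x) \<le> 4 * exp 1 * K * real (floor_sqrt n) * norm x"
proof -
  define w where "w = floor_sqrt n"
  have w: "w ^ 2 \<le> n" "n < (Suc w) ^ 2" "1 \<le> w"
    using assms(3) by (auto simp: w_def Suc_floor_sqrt_power2_gt le_floor_sqrt_iff)
  have "w \<le> n" using w(1) by (metis le_square order_trans power2_eq_square)
  \<comment> \<open>Normalisation: by \<open>exp_le_window\<close> every weight in the window
    becomes at least 1 after multiplication by \<open>c\<close>.\<close>
  define c where "c = 2 * exp 1 * sqrt (real n) / exp (real n)"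
  have c: "0 \<le> c" by (simp add: c_def)
  have cm: "1 \<le> c * (real n ^ (n - m) / fact (n - m))" if "m < w" for m
  proof -
    have "m ^ 2 \<le> n" using that w(1) by (meson less_imp_le_nat order_trans power_mono zero_le)
    from exp_le_window[OF assms(3) this] show ?thesis
      unfolding c_def by (simp add: field_simps)
  qed
  have nonneg: "0 \<le> (A ^^ k) x" for k using funpow_nonneg[OF pos \<open>0 \<le> x\<close>] .
  have "(\<Sum>m<w. (A ^^ (n - m)) x) \<le> (\<Sum>m<w. (c * (real n ^ (n - m) / fact (n - m))) *\<^sub>R (A ^^ (n - m)) x)"
  proof (rule sum_mono)
    fix m assume "m \<in> {..<w}"
    then show "(A ^^ (n - m)) x \<le> (c * (real n ^ (n - m) / fact (n - m))) *\<^sub>R (A ^^ (n - m)) x"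
      using scaleR_right_mono[OF cm nonneg, of m "n - m"] by simp
  qed
  also have "\<dots> = (\<Sum>k\<in>(\<lambda>m. n - m) ` {..<w}. (c * (real n ^ k / fact k)) *\<^sub>R (A ^^ k) x)"
    by (subst sum.reindex) (use \<open>w \<le> n\<close> in \<open>auto simp: inj_on_def\<close>)
  \<comment> \<open>All terms are positive, so the window may be enlarged to a full partial sum of
    the exponential at \<open>t = n\<close>.\<close>
  also have "\<dots> \<le> (\<Sum>k\<le>n. (c * (real n ^ k / fact k)) *\<^sub>R (A ^^ k) x)"
    using c nonneg by (intro sum_mono2) (auto intro!: scaleR_nonneg_nonneg)
  also have "\<dots> = c *\<^sub>R (\<Sum>k\<le>n. (real n ^ k / fact k) *\<^sub>R (A ^^ k) x)"
    by (simp add: scaleR_sum_right)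
  finally have "norm (\<Sum>m<w. (A ^^ (n - m)) x) \<le> norm (c *\<^sub>R (\<Sum>k\<le>n. (real n ^ k / fact k) *\<^sub>R (A ^^ k) x))"
    by (intro norm_mono_nonneg sum_nonneg nonneg)
  also have "\<dots> \<le> c * (K * exp (real n) * norm x)"
    using c exp[of "real n" x n] assms(3,5) by (simp add: mult_left_mono)
  also have "\<dots> = 2 * exp 1 * K * norm x * sqrt (real n)"
    by (simp add: c_def)
  \<comment> \<open>\<open>sqrt n\<close> is less than \<open>w + 1\<close>, hence at most
    \<open>2 w\<close>; this makes the 2 of \<open>exp_le_window\<close> a 4.\<close>
  also have "\<dots> \<le> 2 * exp 1 * K * norm x * (2 * real w)"
  proof (rule mult_left_mono)
    have "real n \<le> (2 * real w) ^ 2"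
    proof -
      have "real n \<le> real (Suc w) ^ 2"
        using w(2) by (metis less_imp_le of_nat_le_iff of_nat_power)
      also have "\<dots> \<le> (2 * real w) ^ 2" using w(3) by (intro power_mono) auto
      finally show ?thesis .
    qed
    then show "sqrt (real n) \<le> 2 * real w" by (intro real_le_lsqrt) auto
  qed (use \<open>0 \<le> K\<close> in auto)
  finally show ?thesis by (simp add: w_def mult_ac)
qed

section \<open>From powers of the resolvent to the exponential\<close>

lemma power_Suc_diff_le:
  fixes x :: real
  assumes "0 \<le> x"
  shows "(x + 1) ^ Suc k - x ^ Suc k \<le> real (Suc k) * (x + 1) ^ k"
proof (induction k)
  case (Suc k)
  have "(x + 1) ^ Suc (Suc k) - x ^ Suc (Suc k) = (x + 1) * ((x + 1) ^ Suc k - x ^ Suc k) + x ^ Suc k"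
    by (simp add: algebra_simps)
  also have "\<dots> \<le> (x + 1) * (real (Suc k) * (x + 1) ^ k) + (x + 1) ^ Suc k"
    using assms Suc by (intro add_mono mult_left_mono power_mono) auto
  finally show ?case by (simp add: algebra_simps)
qed simp

text \<open>Here \<open>J = (1 - B)\<^sup>-\<^sup>1\<close>; the coefficient of \<open>B\<^sup>k\<close> in \<open>J\<^sup>n\<close> is \<open>(n + k - 1) choose k\<close>,
  which is at least \<open>n\<^sup>k / k!\<close>.\<close>

lemma resolvent_power_ge:
  fixes B J :: "'a::banach_lattice \<Rightarrow> 'a"
  assumes "linear B" and posB: "\<And>x. 0 \<le> x \<Longrightarrow> 0 \<le> B x" and posJ: "\<And>x. 0 \<le> x \<Longrightarrow> 0 \<le> J x"
    and J: "\<And>x. J x = x + B (J x)" and "0 \<le> x"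
  shows "(\<Sum>k\<le>N. (real n ^ k / fact k) *\<^sub>R (B ^^ k) x) \<le> (J ^^ n) x"
proof (induction n arbitrary: N)
  case 0
  have "(\<Sum>k\<le>N. (real 0 ^ k / fact k) *\<^sub>R (B ^^ k) x) = (\<Sum>k\<le>N. if k = 0 then x else 0)"
    by (intro sum.cong) auto
  then show ?case by simp
next
  case (Suc n)
  have Bmono: "B a \<le> B b" if "a \<le> b" for a b
    using posB[of "b - a"] that linear_diff[OF assms(1)] by simp
  have nonneg: "0 \<le> (B ^^ k) x" "0 \<le> (J ^^ k) x" for k
    using funpow_nonneg[OF posB \<open>0 \<le> x\<close>] funpow_nonneg[OF posJ \<open>0 \<le> x\<close>] by auto
  have step: "(J ^^ Suc n) x = (J ^^ n) x + B ((J ^^ Suc n) x)"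
    using J[of "(J ^^ n) x"] by simp
  \<comment> \<open>\<open>B\<close> raises the degree, so the case \<open>Suc n\<close>,
    \<open>Suc N\<close> rests on the cases \<open>n\<close>, \<open>Suc N\<close> and
    \<open>Suc n\<close>, \<open>N\<close>. Hence an inner induction on \<open>N\<close>.\<close>
  show ?case
  proof (induction N)
    case 0
    have "x \<le> (J ^^ n) x" using Suc.IH[of 0] by simp
    also have "\<dots> \<le> (J ^^ Suc n) x"
      using posB[OF nonneg(2)[of "Suc n"]] by (subst step) (simp del: funpow.simps)
    finally show ?case by simp
  next
    case (Suc N)
    let ?c = "\<lambda>n k. real n ^ k / fact k"
    \<comment> \<open>The Pascal-type recursion that \<open>step\<close> imposes on exact
      coefficients holds for \<open>?c\<close> as an inequality in the required direction.\<close>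
    have c: "?c (Suc n) (Suc k) \<le> ?c n (Suc k) + ?c (Suc n) k" for k
    proof -
      have "real (Suc n) ^ Suc k \<le> real n ^ Suc k + real (Suc k) * real (Suc n) ^ k"
        using power_Suc_diff_le[of "real n" k] by (simp add: algebra_simps)
      then have "real (Suc n) ^ Suc k / fact (Suc k)
          \<le> (real n ^ Suc k + real (Suc k) * real (Suc n) ^ k) / fact (Suc k)"
        by (intro divide_right_mono) auto
      also have "\<dots> = ?c n (Suc k) + ?c (Suc n) k"
        by (simp add: add_divide_distrib del: of_nat_Suc)
      finally show ?thesis .
    qed
    have "(\<Sum>k\<le>Suc N. ?c (Suc n) k *\<^sub>R (B ^^ k) x)
        = x + (\<Sum>k\<le>N. ?c (Suc n) (Suc k) *\<^sub>R (B ^^ Suc k) x)"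
      by (subst sum.atMost_Suc_shift) simp
    also have "\<dots> \<le> x + (\<Sum>k\<le>N. (?c n (Suc k) + ?c (Suc n) k) *\<^sub>R (B ^^ Suc k) x)"
      by (intro add_left_mono sum_mono scaleR_right_mono c nonneg)
    also have "\<dots> = (\<Sum>k\<le>Suc N. ?c n k *\<^sub>R (B ^^ k) x) + B (\<Sum>k\<le>N. ?c (Suc n) k *\<^sub>R (B ^^ k) x)"
      by (subst sum.atMost_Suc_shift)
        (simp add: scaleR_add_left sum.distrib linear_sum[OF assms(1)] linear_scale[OF assms(1)])
    also have "\<dots> \<le> (J ^^ n) x + B ((J ^^ Suc n) x)"
      by (intro add_mono Suc.IH Suc.prems Bmono \<open>\<And>N. (\<Sum>k\<le>N. ?c n k *\<^sub>R (B ^^ k) x) \<le> (J ^^ n) x\<close>)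
    finally show ?case using step by simp
  qed
qed

text \<open>Neumann series: iterating the equation shows that \<open>y - (B ^^ n) y\<close> is
  positive, and \<open>(B ^^ n) y\<close> tends to 0. This gives positivity of the resolvent at
  large arguments.\<close>

lemma nonneg_if_eq_add_contraction:
  fixes B :: "'a::banach_lattice \<Rightarrow> 'a"
  assumes "linear B" and posB: "\<And>x. 0 \<le> x \<Longrightarrow> 0 \<le> B x"
    and r: "\<And>x. norm (B x) \<le> r * norm x" "0 \<le> r" "r < 1"
    and y: "y = x + B y" "0 \<le> x"
  shows "0 \<le> y"
proof -
  have norm: "norm ((B ^^ n) y) \<le> r ^ n * norm y" for n
  proof (induction n)
    case (Suc n)
    have "norm ((B ^^ Suc n) y) \<le> r * norm ((B ^^ n) y)" using r(1) by simp
    also have "\<dots> \<le> r * (r ^ n * norm y)" using Suc r(2) by (intro mult_left_mono)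
    finally show ?case by simp
  qed simp
  have "(\<lambda>n. r ^ n * norm y) \<longlonglongrightarrow> 0 * norm y"
    using r(2,3) by (intro tendsto_mult LIMSEQ_power_zero tendsto_const) simp
  then have "(\<lambda>n. (B ^^ n) y) \<longlonglongrightarrow> 0"
    by (intro Lim_null_comparison[OF always_eventually[OF allI[OF norm]]]) simp
  then have "(\<lambda>n. y - (B ^^ n) y) \<longlonglongrightarrow> y - 0"
    by (intro tendsto_intros)
  moreover have "0 \<le> y - (B ^^ n) y" for n
  proof (induction n)
    case (Suc n)
    have "0 \<le> x + B (y - (B ^^ n) y)" using posB[OF Suc] y(2) by (rule add_nonneg_nonneg[rotated])
    also have "\<dots> = (x + B y) - (B ^^ Suc n) y" by (simp add: linear_diff[OF assms(1)])
    also have "x + B y = y" by (rule y(1)[symmetric])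
    finally show ?case .
  qed simp
  ultimately have "0 \<le> y - 0" by (rule tendsto_nonneg_lattice)
  then show ?thesis by simp
qed

text \<open>With \<open>l = n / t\<close> the operator \<open>l Q l\<close> inverts
  \<open>1 - t A / n\<close>. Its \<open>n\<close>-th power dominates the partial sum by
  \<open>resolvent_power_ge\<close>, and its norm is at most \<open>K\<close> times the inverse of
  \<open>(1 - t / n) ^ n\<close>, which tends to \<open>K * exp t\<close>.\<close>

lemma exp_bound_of_resolvent_powers:
  fixes A :: "'a::banach_lattice \<Rightarrow> 'a"
  assumes "linear A" and pos: "\<And>x. 0 \<le> x \<Longrightarrow> 0 \<le> A x"
    and M: "\<And>x. norm (A x) \<le> M * norm x" "0 \<le> M"
    and Q: "\<And>l. 1 < l \<Longrightarrow> linear (Q l)" "\<And>l x. 1 < l \<Longrightarrow> l *\<^sub>R Q l x - A (Q l x) = x"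
      "\<And>l n x. 1 < l \<Longrightarrow> 1 \<le> n \<Longrightarrow> norm ((Q l ^^ n) x) \<le> K / (l - 1) ^ n * norm x"
    and "0 < t" "0 \<le> x"
  shows "norm (\<Sum>k\<le>N. (t ^ k / fact k) *\<^sub>R (A ^^ k) x) \<le> K * exp t * norm x"
proof (rule Lim_bounded2)
  have "(\<lambda>n. inverse ((1 + (- t) / real n) ^ n)) \<longlonglongrightarrow> inverse (exp (- t))"
    by (intro tendsto_inverse tendsto_exp_limit_sequentially) simp
  then show "(\<lambda>n. K * inverse ((1 + (- t) / real n) ^ n) * norm x) \<longlonglongrightarrow> K * exp t * norm x"
    by (intro tendsto_intros) (simp add: exp_minus)
  \<comment> \<open>From \<open>n0\<close> on, \<open>l = n / t\<close> exceeds
    \<open>M + 1\<close>: then \<open>A / l\<close> is a strict contraction and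
    \<open>l > 1\<close>, as the resolvent bound requires.\<close>
  define n0 where "n0 = nat \<lceil>t * (M + 1)\<rceil> + 1"
  show "\<forall>n\<ge>n0. norm (\<Sum>k\<le>N. (t ^ k / fact k) *\<^sub>R (A ^^ k) x)
    \<le> K * inverse ((1 + (- t) / real n) ^ n) * norm x"
  proof (intro allI impI)
    fix n assume "n0 \<le> n"
    then have n: "t * (M + 1) < real n" "1 \<le> n" unfolding n0_def by linarith+
    define l where "l = real n / t"
    have l: "M + 1 < l" "1 < l" "0 < l"
      using n \<open>0 < t\<close> M(2) by (auto simp: l_def field_simps intro: le_less_trans[rotated])
    define B where "B y = inverse l *\<^sub>R A y" for y
    define J where "J y = l *\<^sub>R Q l y" for y
    have linB: "linear B"
      unfolding B_def using linear_compose_scale_right[OF assms(1)] by simp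
    have posB: "0 \<le> B y" if "0 \<le> y" for y
      using pos[OF that] l by (simp add: B_def scaleR_nonneg_nonneg)
    have J: "J y = y + B (J y)" for y
    proof -
      have "B (J y) = A (Q l y)" using l by (simp add: J_def B_def linear_scale[OF assms(1)])
      then show ?thesis using Q(2)[OF l(2), of y] by (simp add: J_def algebra_simps)
    qed
    have posJ: "0 \<le> J y" if "0 \<le> y" for y
    proof (rule nonneg_if_eq_add_contraction[OF linB posB _ _ _ J that])
      show "norm (B z) \<le> (M / l) * norm z" for z
        using M(1)[of z] l by (simp add: B_def field_simps)
    qed (use l M in auto)
    have Bk: "(B ^^ k) x = inverse (l ^ k) *\<^sub>R (A ^^ k) x" for k
      by (induction k) (simp_all add: B_def linear_scale[OF assms(1)])
    have Jk: "(J ^^ k) x = l ^ k *\<^sub>R (Q l ^^ k) x" for k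
      by (induction k) (simp_all add: J_def linear_scale[OF Q(1)[OF l(2)]])
    have "(real n ^ k / fact k) *\<^sub>R (B ^^ k) x = (t ^ k / fact k) *\<^sub>R (A ^^ k) x" for k
      using \<open>0 < t\<close> n(2) by (simp add: Bk l_def power_divide)
    then have "(\<Sum>k\<le>N. (t ^ k / fact k) *\<^sub>R (A ^^ k) x) \<le> l ^ n *\<^sub>R (Q l ^^ n) x"
      using resolvent_power_ge[of B J x n N] linB posB posJ J \<open>0 \<le> x\<close> Jk[of n] by simp
    then have "norm (\<Sum>k\<le>N. (t ^ k / fact k) *\<^sub>R (A ^^ k) x) \<le> norm (l ^ n *\<^sub>R (Q l ^^ n) x)"
      using \<open>0 < t\<close> \<open>0 \<le> x\<close>
      by (intro norm_mono_nonneg sum_nonneg scaleR_nonneg_nonneg funpow_nonneg pos) auto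
    also have "\<dots> \<le> l ^ n * (K / (l - 1) ^ n * norm x)"
      using mult_left_mono[OF Q(3)[OF l(2) n(2), of x], of "l ^ n"] l by simp
    also have "\<dots> = K * inverse (((l - 1) / l) ^ n) * norm x"
      by (simp add: power_divide field_simps)
    also have "(l - 1) / l = 1 + (- t) / real n"
      using l n(2) \<open>0 < t\<close> by (simp add: l_def field_simps)
    finally show "norm (\<Sum>k\<le>N. (t ^ k / fact k) *\<^sub>R (A ^^ k) x)
      \<le> K * inverse ((1 + (- t) / real n) ^ n) * norm x" .
  qed
qed

section \<open>Growth of powers\<close>

text \<open>The integer form of \<open>ln_floor_sqrt_le\<close>. The shift by 2 spoils the ratio
  \<open>1 / 2\<close> of logarithms for small \<open>n\<close>, whereas \<open>4 / 5\<close> holds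
  from 2 on, narrowly at \<open>n = 2\<close>, where \<open>3 ^ 5 = 243\<close> and
  \<open>4 ^ 4 = 256\<close>. For \<open>w \<ge> 4\<close> one has
  \<open>w + 2 \<le> 2 w\<close>.\<close>

lemma floor_sqrt_add_2_power_le:
  assumes "2 \<le> n"
  shows "(floor_sqrt n + 2) ^ 5 \<le> (n + 2) ^ 4"
proof -
  define w where "w = floor_sqrt n"
  have w: "1 \<le> w" "w ^ 2 \<le> n" using assms by (auto simp: w_def le_floor_sqrt_iff)
  consider "w = 1" "2 \<le> n" | "w = 2" "4 \<le> n" | "w = 3" "9 \<le> n" | "4 \<le> w"
    using w assms by (cases "w = 1"; cases "w = 2"; cases "w = 3") auto
  then show ?thesis
  proof cases
    case 4
    have "2 ^ 5 * w ^ 5 \<le> 4 ^ 3 * w ^ 5" by simp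
    also have "\<dots> \<le> w ^ 3 * w ^ 5" using 4 by (intro mult_right_mono power_mono) auto
    also have "\<dots> = (w ^ 2) ^ 4" by (simp flip: power_mult power_add)
    also have "\<dots> \<le> (n + 2) ^ 4" using w by (intro power_mono) auto
    finally have "(2 * w) ^ 5 \<le> (n + 2) ^ 4" by (simp only: power_mult_distrib)
    moreover have "(w + 2) ^ 5 \<le> (2 * w) ^ 5" using 4 by (intro power_mono) auto
    ultimately show ?thesis by (simp add: w_def)
  next
    case 1
    have "(4::nat) ^ 4 \<le> (n + 2) ^ 4" using 1(2) by (intro power_mono) auto
    then have "3 ^ 5 \<le> (n + 2) ^ 4" by simp
    moreover have "w + 2 = 3" using 1 by simp
    ultimately show ?thesis unfolding w_def[symmetric] by (simp only:)
  next
    case 2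
    have "(6::nat) ^ 4 \<le> (n + 2) ^ 4" using 2(2) by (intro power_mono) auto
    then have "4 ^ 5 \<le> (n + 2) ^ 4" by simp
    moreover have "w + 2 = 4" using 2 by simp
    ultimately show ?thesis unfolding w_def[symmetric] by (simp only:)
  next
    case 3
    have "(11::nat) ^ 4 \<le> (n + 2) ^ 4" using 3(2) by (intro power_mono) auto
    then have "5 ^ 5 \<le> (n + 2) ^ 4" by simp
    moreover have "w + 2 = 5" using 3 by simp
    ultimately show ?thesis unfolding w_def[symmetric] by (simp only:)
  qed
qed

lemma ln_floor_sqrt_le:
  assumes "2 \<le> n"
  shows "ln (real (floor_sqrt n) + 2) \<le> 4 / 5 * ln (real n + 2)"
proof -
  have "real ((floor_sqrt n + 2) ^ 5) \<le> real ((n + 2) ^ 4)"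
    using floor_sqrt_add_2_power_le[OF assms] by (simp only: of_nat_le_iff)
  then have "(real (floor_sqrt n) + 2) ^ 5 \<le> (real n + 2) ^ 4"
    by (simp only: of_nat_power of_nat_add of_nat_numeral)
  then have "ln ((real (floor_sqrt n) + 2) ^ 5) \<le> ln ((real n + 2) ^ 4)"
    by (subst ln_le_cancel_iff) (simp_all add: add_nonneg_pos)
  then show ?thesis by (simp add: ln_realpow add_nonneg_pos)
qed

text \<open>Inserting the claimed bound at \<open>w = floor_sqrt n\<close> into \<open>rec\<close>
  gives \<open>w powr (2 a)\<close>, at most \<open>n powr a\<close>, and one surplus factor
  \<open>C\<close>. The logarithm shrinks by the factor \<open>4 / 5\<close>, so the surplus is
  absorbed when \<open>C * (4 / 5) powr b = 1\<close>; this fixes \<open>b\<close>.\<close>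

lemma growth_of_sqrt_recursion:
  fixes A :: "'a::banach_lattice \<Rightarrow> 'a"
  assumes rec: "\<And>n B x. 1 \<le> n \<Longrightarrow> 0 < B \<Longrightarrow>
      (\<And>m x. m < floor_sqrt n \<Longrightarrow> 0 \<le> x \<Longrightarrow> norm ((A ^^ m) x) \<le> B * norm x) \<Longrightarrow>
      0 \<le> x \<Longrightarrow> norm ((A ^^ n) x) \<le> C * real (floor_sqrt n) powr a * B * norm x"
    and C: "1 \<le> C" and a: "0 \<le> a" and "1 \<le> n" "0 \<le> x"
  shows "norm ((A ^^ n) x) \<le> C * real n powr a * ln (real n + 2) powr (ln C / ln (5 / 4)) * norm x"
proof -
  define b where "b = ln C / ln (5 / 4)"
  have b: "0 \<le> b" using C by (simp add: b_def)
  have ln1: "1 \<le> ln (real n + 2)" if "1 \<le> n" for n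
  proof -
    have "exp 1 \<le> real n + 2" using that exp_le by linarith
    then show ?thesis using ln_le_cancel_iff[of "exp 1" "real n + 2"] by simp
  qed
  have Cb: "C * (4 / 5) powr b = 1"
  proof -
    have "(5 / 4) powr b = C" using C by (simp add: b_def powr_def)
    moreover have "(4 / 5) powr b = inverse ((5 / 4) powr b)"
      by (simp flip: powr_minus add: powr_minus_divide powr_divide)
    ultimately show ?thesis using C by simp
  qed
  have "\<forall>x\<ge>0. norm ((A ^^ n) x) \<le> C * real n powr a * ln (real n + 2) powr b * norm x"
    using \<open>1 \<le> n\<close>
  proof (induction n rule: less_induct)
    case (less n)
    define w where "w = floor_sqrt n"
    have w: "1 \<le> w" "w ^ 2 \<le> n" using less.prems by (auto simp: w_def le_floor_sqrt_iff)
    show ?case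
    proof (cases "n = 1")
      case True
      \<comment> \<open>Here \<open>w = n\<close>, so the induction hypothesis cannot be used; but
        the window contains only \<open>m = 0\<close>, and \<open>rec\<close> applies with
        \<open>B = 1\<close>.\<close>
      have "norm ((A ^^ n) x) \<le> C * 1 * 1 * norm x" if "0 \<le> x" for x
        using rec[of n 1 x] that True by simp
      moreover have "C * 1 * 1 * norm x \<le> C * real n powr a * ln (real n + 2) powr b * norm x" for x :: 'a
        using C a b ln1[of n] True by (intro mult_right_mono mult_mono ge_one_powr_ge_zero) auto
      ultimately show ?thesis by (meson order_trans)
    next
      case False
      then have n: "2 \<le> n" using less.prems by simp
      have "w < n"
      proof (cases "w = 1")
        case False
        then have "w * 2 \<le> w ^ 2" using w(1) by (simp add: power2_eq_square)
        then show ?thesis using w by linarith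
      qed (use n in simp)
      \<comment> \<open>The induction bound at \<open>w\<close>, which dominates those at smaller
        positive \<open>m\<close>. For \<open>m = 0\<close> no induction bound is at hand, and
        \<open>1 \<le> B\<close> is used instead.\<close>
      define B where "B = C * real w powr a * ln (real w + 2) powr b"
      have 1: "1 \<le> real w powr a" "1 \<le> ln (real w + 2) powr b"
        using w a b ln1[of w] by (auto intro: ge_one_powr_ge_zero)
      have "1 * 1 * 1 \<le> B" unfolding B_def using 1 C by (intro mult_mono) auto
      have "norm ((A ^^ m) x) \<le> B * norm x" if m: "m < w" and x: "0 \<le> x" for m x
      proof (cases "m = 0")
        case True
        then show ?thesis using mult_right_mono[OF \<open>1 * 1 * 1 \<le> B\<close>, of "norm x"] by simp
      next
        case False
        then have "norm ((A ^^ m) x) \<le> C * real m powr a * ln (real m + 2) powr b * norm x"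
          using less.IH[of m] m x \<open>w < n\<close> by auto
        also have "\<dots> \<le> B * norm x"
          unfolding B_def using m C a b False ln1[of m]
          by (intro mult_right_mono mult_mono powr_mono2) auto
        finally show ?thesis .
      qed
      then have *: "norm ((A ^^ n) x) \<le> C * real w powr a * B * norm x" if "0 \<le> x" for x
        using rec[of n B x] less.prems \<open>1 * 1 * 1 \<le> B\<close> that unfolding w_def by simp
      have "C * real w powr a * B \<le> C * real n powr a * ln (real n + 2) powr b"
      proof -
        have "C * real w powr a * B = C * (real w powr a * real w powr a) * (C * ln (real w + 2) powr b)"
          by (simp add: B_def mult_ac)
        also have "real w powr a * real w powr a = real (w ^ 2) powr a"
          by (simp add: power2_eq_square powr_mult)
        also have "C * ln (real w + 2) powr b \<le> C * (4 / 5 * ln (real n + 2)) powr b"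
          using C b ln_floor_sqrt_le[OF n] ln1[OF w(1)]
          by (intro mult_left_mono powr_mono2) (auto simp: w_def)
        also have "\<dots> = ln (real n + 2) powr b"
          using ln1[OF less.prems] Cb powr_mult[of "4 / 5" "ln (real n + 2)" b]
          by (simp only: mult.assoc[symmetric])
        also have "C * real (w ^ 2) powr a * ln (real n + 2) powr b \<le> C * real n powr a * ln (real n + 2) powr b"
          using C a w(2) by (intro mult_right_mono mult_left_mono powr_mono2) auto
        finally show ?thesis using C by (simp add: mult_left_mono)
      qed
      then show ?thesis using * by (meson mult_right_mono norm_ge_zero order_trans)
    qed
  qed
  then show ?thesis using \<open>0 \<le> x\<close> by (simp add: b_def)
qed

lemma upper_estimate_growth:
  fixes A :: "'a::banach_lattice \<Rightarrow> 'a"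
  assumes "linear A" and pos: "\<And>x. 0 \<le> x \<Longrightarrow> 0 \<le> A x"
    and window: "\<And>n x. 1 \<le> n \<Longrightarrow> 0 \<le> x \<Longrightarrow>
      norm (\<Sum>m<floor_sqrt n. (A ^^ (n - m)) x) \<le> C * real (floor_sqrt n) * norm x"
    and upper: "\<And>w f B. 0 < w \<Longrightarrow> (\<And>m. m < w \<Longrightarrow> 0 \<le> f m \<and> norm (f m) \<le> B) \<Longrightarrow>
      \<exists>g::'a\<ge>0. (\<forall>m<w. f m \<le> g) \<and> norm g \<le> real w powr a * B"
    and "1 \<le> C" "0 \<le> a" "1 \<le> n" "0 \<le> x"
  shows "norm ((A ^^ n) x) \<le> C * real n powr a * ln (real n + 2) powr (ln C / ln (5 / 4)) * norm x"
proof (rule growth_of_sqrt_recursion[OF _ assms(5-8)])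
  fix n :: nat and B :: real and x :: 'a
  assume n: "1 \<le> n" and "0 < B" and x: "0 \<le> x"
    and small: "\<And>m x. m < floor_sqrt n \<Longrightarrow> 0 \<le> x \<Longrightarrow> norm ((A ^^ m) x) \<le> B * norm x"
  define w where "w = floor_sqrt n"
  have w: "0 < w" "w \<le> n" using n by (auto simp: w_def floor_sqrt_le)
  have "mono A"
  proof (rule monoI)
    fix y z :: 'a assume "y \<le> z"
    then show "A y \<le> A z" using pos[of "z - y"] linear_diff[OF assms(1)] by simp
  qed
  have "0 \<le> (A ^^ m) x \<and> norm ((A ^^ m) x) \<le> B * norm x" if "m < w" for m
    using small[of m x] that x funpow_nonneg[OF pos x] by (simp add: w_def)
  from upper[OF w(1), of "\<lambda>m. (A ^^ m) x", OF this]
  obtain g where g: "0 \<le> g" "\<forall>m<w. (A ^^ m) x \<le> g" "norm g \<le> real w powr a * (B * norm x)"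
    by blast
  have "real w *\<^sub>R (A ^^ n) x = (\<Sum>m<w. (A ^^ n) x)" by (simp add: sum_constant_scaleR)
  also have "\<dots> = (\<Sum>m<w. (A ^^ (n - m)) ((A ^^ m) x))"
    using w(2) by (intro sum.cong refl) (simp flip: funpow_add comp_apply[of "A ^^ _" "A ^^ _"])
  also have "\<dots> \<le> (\<Sum>m<w. (A ^^ (n - m)) g)"
    using g(2) by (intro sum_mono funpow_mono[OF \<open>mono A\<close>]) auto
  finally have "norm (real w *\<^sub>R (A ^^ n) x) \<le> norm (\<Sum>m<w. (A ^^ (n - m)) g)"
    using funpow_nonneg[OF pos x] by (intro norm_mono_nonneg scaleR_nonneg_nonneg) auto
  also have "\<dots> \<le> C * real w * norm g"
    using window[OF n g(1)] by (simp add: w_def)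
  also have "\<dots> \<le> C * real w * (real w powr a * (B * norm x))"
    using g(3) \<open>1 \<le> C\<close> by (intro mult_left_mono) auto
  finally have "real w * norm ((A ^^ n) x) \<le> real w * (C * real w powr a * B * norm x)"
    by (simp add: mult_ac)
  then show "norm ((A ^^ n) x) \<le> C * real (floor_sqrt n) powr a * B * norm x"
    using w(1) by (simp add: w_def)
qed

text \<open>Dual to \<open>upper_estimate_growth\<close>. There the small powers act first and are
  majorised together; here they act last, so that dividing by \<open>B\<close> bounds every window
  term from below by one number.\<close>

lemma lower_estimate_growth:
  fixes A :: "'a::banach_lattice \<Rightarrow> 'a"
  assumes pos: "\<And>x. 0 \<le> x \<Longrightarrow> 0 \<le> A x"
    and window: "\<And>n x. 1 \<le> n \<Longrightarrow> 0 \<le> x \<Longrightarrow>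
      norm (\<Sum>m<floor_sqrt n. (A ^^ (n - m)) x) \<le> C * real (floor_sqrt n) * norm x"
    and lower: "\<And>w f b. 0 < w \<Longrightarrow> 0 \<le> b \<Longrightarrow> (\<And>m. m < w \<Longrightarrow> 0 \<le> f m \<and> b \<le> norm (f m)) \<Longrightarrow>
      real w * b \<le> real w powr a * norm (\<Sum>m<w. f m :: 'a)"
    and "1 \<le> C" "0 \<le> a" "1 \<le> n" "0 \<le> x"
  shows "norm ((A ^^ n) x) \<le> C * real n powr a * ln (real n + 2) powr (ln C / ln (5 / 4)) * norm x"
proof (rule growth_of_sqrt_recursion[OF _ assms(4-7)])
  fix n :: nat and B :: real and x :: 'a
  assume n: "1 \<le> n" and "0 < B" and x: "0 \<le> x"
    and small: "\<And>m x. m < floor_sqrt n \<Longrightarrow> 0 \<le> x \<Longrightarrow> norm ((A ^^ m) x) \<le> B * norm x"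
  define w where "w = floor_sqrt n"
  have w: "0 < w" "w \<le> n" using n by (auto simp: w_def floor_sqrt_le)
  have "norm ((A ^^ n) x) / B \<le> norm ((A ^^ (n - m)) x)" if "m < w" for m
  proof -
    have "(A ^^ n) x = (A ^^ m) ((A ^^ (n - m)) x)"
      using that w(2) by (simp flip: funpow_add comp_apply[of "A ^^ _" "A ^^ _"])
    then show ?thesis
      using small[of m "(A ^^ (n - m)) x"] that funpow_nonneg[OF pos x] \<open>0 < B\<close>
      by (simp add: w_def field_simps)
  qed
  then have "real w * (norm ((A ^^ n) x) / B) \<le> real w powr a * norm (\<Sum>m<w. (A ^^ (n - m)) x)"
    using \<open>0 < B\<close> by (intro lower[OF w(1)]) (auto intro: funpow_nonneg[OF pos x])
  also have "\<dots> \<le> real w powr a * (C * real w * norm x)"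
    using window[OF n x] by (intro mult_left_mono) (auto simp: w_def)
  finally have "real w * (norm ((A ^^ n) x) / B) \<le> real w * (C * real w powr a * norm x)"
    by (simp add: mult_ac)
  then have "norm ((A ^^ n) x) / B \<le> C * real w powr a * norm x"
    using w(1) by (simp del: times_divide_eq_right)
  then show "norm ((A ^^ n) x) \<le> C * real (floor_sqrt n) powr a * B * norm x"
    using \<open>0 < B\<close> by (simp add: w_def field_simps)
qed

section \<open>Positive operators on complex Banach lattices\<close>

text \<open>For positive \<open>T\<close> this is the restriction to real elements, by
  \<open>positive_operator_of_real\<close>. Projecting with \<open>cRe\<close> makes sense for every
  operator, in particular for resolvents before anything is known about their positivity.\<close>

definition real_restriction ::
    "('a::banach_lattice complexification \<Rightarrow> 'a complexification) \<Rightarrow> 'a \<Rightarrow> 'a"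
  where "real_restriction T x = cRe (T (Complexification x 0))"

lemma bounded_linear_real_restriction:
  assumes "bounded_linear T"
  shows "bounded_linear (real_restriction T)"
proof (rule bounded_linear_intro[of _ "onorm T"])
  interpret T: bounded_linear T by fact
  have add: "Complexification (x + y) 0 = Complexification x 0 + Complexification y 0"
    and scale: "Complexification (r *\<^sub>R x) 0 = r *\<^sub>R Complexification x 0" for x y :: 'a and r
    by (simp_all add: complexification_ops)
  show "real_restriction T (x + y) = real_restriction T x + real_restriction T y" for x y
    unfolding real_restriction_def add T.add by (simp add: plus_complexification_def)
  show "real_restriction T (r *\<^sub>R x) = r *\<^sub>R real_restriction T x" for r x
    unfolding real_restriction_def scale T.scale by (simp add: scaleR_complexification_def)
  show "norm (real_restriction T x) \<le> norm x * onorm T" for x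
    using order_trans[OF norm_cRe_le onorm[OF assms, of "Complexification x 0"]]
    by (simp add: real_restriction_def norm_Complexification_0 mult.commute)
qed

lemma real_restriction_nonneg:
  assumes "positive_operator T" "0 \<le> x"
  shows "0 \<le> real_restriction T x"
  using assms(1)[unfolded positive_operator_def, rule_format, of "Complexification x 0"] assms(2)
  by (simp add: real_restriction_def less_eq_complexification_def zero_complexification_def)

text \<open>A real element is a difference of two positive ones, whose images are real.\<close>

lemma positive_operator_of_real:
  assumes "bounded_linear T" "positive_operator T"
  shows "T (Complexification x 0) = Complexification (real_restriction T x) 0"
proof -
  interpret T: bounded_linear T by fact
  have im: "cIm (T (Complexification y 0)) = 0" if "0 \<le> y" for y
    using assms(2)[unfolded positive_operator_def, rule_format, of "Complexification y 0"] that
    by (simp add: less_eq_complexification_def zero_complexification_def)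
  have "Complexification x 0 = Complexification (pprt x) 0 - Complexification (- nprt x) 0"
    by (simp add: minus_complexification_def flip: prts)
  then have "T (Complexification x 0) = T (Complexification (pprt x) 0) - T (Complexification (- nprt x) 0)"
    by (simp add: T.diff)
  then have "cIm (T (Complexification x 0)) = 0"
    using im[of "pprt x"] im[of "- nprt x"] by (simp add: minus_complexification_def)
  then show ?thesis
    by (simp add: real_restriction_def complexification_eq_iff)
qed

lemma positive_operator_eq:
  assumes "bounded_clinear T" "positive_operator T"
  shows "T z = Complexification (real_restriction T (cRe z)) (real_restriction T (cIm z))"
proof -
  have T: "bounded_linear T" "\<And>c z. T (c *\<^sub>C z) = c *\<^sub>C T z"
    using assms(1) by (auto simp: bounded_clinear_def)
  interpret T: bounded_linear T by fact
  have "z = Complexification (cRe z) 0 + \<i> *\<^sub>C Complexification (cIm z) 0"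
    by (simp add: complexification_eq_iff scaleC_def plus_complexification_def)
  then have "T z = T (Complexification (cRe z) 0) + \<i> *\<^sub>C T (Complexification (cIm z) 0)"
    by (metis T.add T(2))
  also have "\<dots> = Complexification (real_restriction T (cRe z)) (real_restriction T (cIm z))"
    unfolding positive_operator_of_real[OF T(1) assms(2)]
    by (simp add: complexification_eq_iff scaleC_def plus_complexification_def)
  finally show ?thesis .
qed

text \<open>Every rotation of \<open>T z\<close> is the image of the same rotation of
  \<open>z\<close>, which lies below \<open>modulus z\<close>.\<close>

lemma modulus_positive_operator_le:
  assumes "bounded_clinear T" "positive_operator T"
  shows "modulus (T z) \<le> real_restriction T (modulus z)"
proof (rule modulus_least)
  fix t
  have "linear (real_restriction T)"
    using assms(1) bounded_linear_real_restriction bounded_linear.linear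
    by (auto simp: bounded_clinear_def)
  note lin = linear_add[OF this] linear_diff[OF this] linear_scale[OF this]
  have "0 \<le> real_restriction T (modulus z - rot z t)"
    using rot_le_modulus[of t z] by (intro real_restriction_nonneg[OF assms(2)]) simp
  then show "rot (T z) t \<le> real_restriction T (modulus z)"
    unfolding positive_operator_eq[OF assms, of z] by (simp add: lin algebra_simps)
qed

text \<open>Iterating \<open>modulus_positive_operator_le\<close> reduces the norm of a power to
  positive real elements, with the same constant.\<close>

lemma onorm_funpow_positive_operator_le:
  assumes "bounded_clinear T" "positive_operator T" "0 \<le> b"
    and le: "\<And>x. 0 \<le> x \<Longrightarrow> norm ((real_restriction T ^^ n) x) \<le> b * norm x"
  shows "onorm (T ^^ n) \<le> b"
proof (rule onorm_bound[OF assms(3)])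
  fix z
  have "linear (real_restriction T)"
    using assms(1) bounded_linear_real_restriction bounded_linear.linear
    by (auto simp: bounded_clinear_def)
  have "modulus ((T ^^ k) z) \<le> (real_restriction T ^^ k) (modulus z)" for k
  proof (induction k)
    case (Suc k)
    have "modulus ((T ^^ Suc k) z) \<le> real_restriction T (modulus ((T ^^ k) z))"
      using modulus_positive_operator_le[OF assms(1,2)] by simp
    also have "\<dots> \<le> real_restriction T ((real_restriction T ^^ k) (modulus z))"
      using real_restriction_nonneg[OF assms(2), of "(real_restriction T ^^ k) (modulus z) - modulus ((T ^^ k) z)"] Suc
      by (simp add: linear_diff[OF \<open>linear (real_restriction T)\<close>])
    finally show ?case by simp
  qed simp
  from norm_mono_nonneg[OF modulus_nonneg this[of n]]
  show "norm ((T ^^ n) z) \<le> b * norm z"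
    using le[OF modulus_nonneg, of z] by (simp add: norm_complexification_def)
qed

text \<open>At real \<open>l\<close> the resolvent commutes with taking real parts, because
  \<open>T\<close> does. So the powers of \<open>Q l\<close> inherit the Kreiss bounds, and
  \<open>exp_bound_of_resolvent_powers\<close> applies on the real lattice.\<close>

lemma strongly_Kreiss_exp_bound:
  fixes T :: "'a::banach_lattice complexification \<Rightarrow> 'a complexification"
  assumes T: "bounded_clinear T" "positive_operator T" and K: "strongly_Kreiss_bounded T K"
    and "0 < t" "0 \<le> x"
  shows "norm (\<Sum>k\<le>N. (t ^ k / fact k) *\<^sub>R (real_restriction T ^^ k) x) \<le> K * exp t * norm x"
proof -
  let ?R = "real_restriction T"
  define Q where "Q l = real_restriction (resolvent T (complex_of_real l))" for l
  have bl: "bounded_linear T" using T(1) by (simp add: bounded_clinear_def)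
  have blR: "bounded_linear ?R" by (rule bounded_linear_real_restriction[OF bl])
  have res: "bij (\<lambda>z. complex_of_real l *\<^sub>C z - T z)" "bounded_linear (resolvent T (complex_of_real l))"
    "\<And>n. 1 \<le> n \<Longrightarrow> onorm (resolvent T (complex_of_real l) ^^ n) \<le> K / (l - 1) ^ n" if "1 < l" for l
    using K[unfolded strongly_Kreiss_bounded_def, rule_format, of "complex_of_real l"] that
    by (auto simp: resolvent_set_def resolvent_def bounded_clinear_def)
  have cRe_res: "cRe (resolvent T (complex_of_real l) z) = Q l (cRe z)"
    and Q: "l *\<^sub>R Q l (cRe z) - ?R (Q l (cRe z)) = cRe z" if "1 < l" for l z
  proof -
    define y where "y = resolvent T (complex_of_real l) z"
    have z: "complex_of_real l *\<^sub>C y - T y = z"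
      unfolding y_def resolvent_def by (rule surj_f_inv_f[OF bij_is_surj[OF res(1)[OF that]]])
    have re: "l *\<^sub>R cRe y - ?R (cRe y) = cRe z"
      unfolding z[symmetric] positive_operator_eq[OF T, of y]
      by (simp add: minus_complexification_def scaleC_def)
    \<comment> \<open>The real part of the solution solves the equation with the real part of the
      right-hand side; injectivity identifies it with the resolvent there.\<close>
    have "complex_of_real l *\<^sub>C Complexification (cRe y) 0 - T (Complexification (cRe y) 0)
        = Complexification (cRe z) 0"
      unfolding positive_operator_of_real[OF bl T(2)] re[symmetric]
      by (simp add: minus_complexification_def scaleC_def)
    then have "resolvent T (complex_of_real l) (Complexification (cRe z) 0) = Complexification (cRe y) 0"
      unfolding resolvent_def by (metis inv_f_f[OF bij_is_inj[OF res(1)[OF that]]])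
    then have "Q l (cRe z) = cRe y" by (simp add: Q_def real_restriction_def)
    then show "cRe (resolvent T (complex_of_real l) z) = Q l (cRe z)"
      "l *\<^sub>R Q l (cRe z) - ?R (Q l (cRe z)) = cRe z"
      using re by (simp_all add: y_def)
  qed
  show ?thesis
  proof (rule exp_bound_of_resolvent_powers[OF _ _ _ _ _ _ _ \<open>0 < t\<close> \<open>0 \<le> x\<close>])
    show "linear ?R" using blR by (rule bounded_linear.linear)
    show "0 \<le> ?R y" if "0 \<le> y" for y by (rule real_restriction_nonneg[OF T(2) that])
    show "norm (?R y) \<le> onorm ?R * norm y" for y by (rule onorm[OF blR])
    show "0 \<le> onorm ?R" by (rule onorm_pos_le[OF blR])
    fix l :: real assume l: "1 < l"
    show "linear (Q l)"
      unfolding Q_def by (rule bounded_linear.linear[OF bounded_linear_real_restriction[OF res(2)[OF l]]])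
    show "l *\<^sub>R Q l y - ?R (Q l y) = y" for y
      using Q[OF l, of "Complexification y 0"] by simp
    fix n :: nat and y :: 'a assume n: "1 \<le> n"
    let ?S = "resolvent T (complex_of_real l)"
    have "cRe ((?S ^^ k) (Complexification y 0)) = (Q l ^^ k) y" for k
      by (induction k) (simp_all add: cRe_res[OF l])
    then have "norm ((Q l ^^ n) y) \<le> norm ((?S ^^ n) (Complexification y 0))"
      by (metis norm_cRe_le)
    also have "bounded_linear (?S ^^ n)"
    proof (induction n)
      case (Suc n)
      then show ?case using bounded_linear_compose[OF res(2)[OF l]] by (simp add: comp_def)
    qed (simp add: id_def bounded_linear_ident)
    then have "norm ((?S ^^ n) (Complexification y 0)) \<le> onorm (?S ^^ n) * norm y"
      using onorm[of "?S ^^ n" "Complexification y 0"] by (simp add: norm_Complexification_0)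
    also have "\<dots> \<le> K / (l - 1) ^ n * norm y"
      using res(3)[OF l n] by (intro mult_right_mono) auto
    finally show "norm ((Q l ^^ n) y) \<le> K / (l - 1) ^ n * norm y" .
  qed
qed

text \<open>The absolute value supplies the nonnegative constant for
  \<open>window_sum_bound\<close>; the \<open>+ 1\<close> makes the result at least 1, so that the
  exponent \<open>ln C / ln (5 / 4)\<close> is nonnegative.\<close>

lemma strongly_Kreiss_window_bound:
  fixes T :: "'a::banach_lattice complexification \<Rightarrow> 'a complexification"
  assumes T: "bounded_clinear T" "positive_operator T" and K: "strongly_Kreiss_bounded T K"
    and "1 \<le> n" "0 \<le> x"
  shows "norm (\<Sum>m<floor_sqrt n. (real_restriction T ^^ (n - m)) x)
    \<le> (4 * exp 1 * \<bar>K\<bar> + 1) * real (floor_sqrt n) * norm x"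
proof -
  have "norm (\<Sum>m<floor_sqrt n. (real_restriction T ^^ (n - m)) x)
      \<le> 4 * exp 1 * \<bar>K\<bar> * real (floor_sqrt n) * norm x"
  proof (rule window_sum_bound[OF real_restriction_nonneg[OF T(2)] _ \<open>1 \<le> n\<close> _ \<open>0 \<le> x\<close>])
    fix N and t :: real and x :: 'a assume "0 < t" "0 \<le> x"
    from strongly_Kreiss_exp_bound[OF T K this, of N]
    show "norm (\<Sum>k\<le>N. (t ^ k / fact k) *\<^sub>R (real_restriction T ^^ k) x) \<le> \<bar>K\<bar> * exp t * norm x"
      by (rule order_trans) (intro mult_right_mono, auto)
  qed auto
  also have "\<dots> \<le> (4 * exp 1 * \<bar>K\<bar> + 1) * real (floor_sqrt n) * norm x"
    by (intro mult_right_mono) auto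
  finally show ?thesis .
qed

theorem theorem4p6:
  fixes Ks :: real
  shows "(\<forall>p::ennreal. 2 < p \<and> p_convex TYPE('a::banach_lattice) p \<longrightarrow>
      (\<exists>C\<ge>0. \<exists>\<beta>\<ge>0. \<forall>T :: 'a complexification \<Rightarrow> 'a complexification.
        bounded_clinear T \<and> positive_operator T \<and> strongly_Kreiss_bounded T Ks \<longrightarrow>
        (\<forall>n\<ge>1. onorm (T ^^ n)
          \<le> C * real n powr enn2real (1 / p) * ln (real n + 2) powr \<beta>))) \<and>
    (\<forall>q q'::ennreal. 1 \<le> q \<and> q < 2 \<and> 1 / q + 1 / q' = 1 \<and> q_concave TYPE('a) q \<longrightarrow>
      (\<exists>C\<ge>0. \<exists>\<beta>\<ge>0. \<forall>T :: 'a complexification \<Rightarrow> 'a complexification.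
        bounded_clinear T \<and> positive_operator T \<and> strongly_Kreiss_bounded T Ks \<longrightarrow>
        (\<forall>n\<ge>1. onorm (T ^^ n)
          \<le> C * real n powr enn2real (1 / q') * ln (real n + 2) powr \<beta>)))"
proof -
  define C where "C = 4 * exp 1 * \<bar>Ks\<bar> + 1"
  have C: "1 \<le> C" by (simp add: C_def)
  \<comment> \<open>Both parts have this shape, with \<open>a\<close> standing for
    \<open>1 / p\<close> or \<open>1 / q'\<close>. The witnesses \<open>C\<close> and
    \<open>ln C / ln (5 / 4)\<close> depend on \<open>Ks\<close> alone.\<close>
  have bound: "\<exists>C\<ge>0. \<exists>\<beta>\<ge>0. \<forall>T :: 'a complexification \<Rightarrow> 'a complexification.
        bounded_clinear T \<and> positive_operator T \<and> strongly_Kreiss_bounded T Ks \<longrightarrow>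
        (\<forall>n\<ge>1. onorm (T ^^ n) \<le> C * real n powr a * ln (real n + 2) powr \<beta>)"
    if *: "\<And>(T :: 'a complexification \<Rightarrow> 'a complexification) n x.
      bounded_clinear T \<Longrightarrow> positive_operator T \<Longrightarrow> strongly_Kreiss_bounded T Ks \<Longrightarrow>
      1 \<le> n \<Longrightarrow> 0 \<le> x \<Longrightarrow> norm ((real_restriction T ^^ n) x)
        \<le> C * real n powr a * ln (real n + 2) powr (ln C / ln (5 / 4)) * norm x" for a
  proof (intro exI conjI allI impI)
    show "0 \<le> C" "0 \<le> ln C / ln (5 / 4)" using C by auto
    fix T :: "'a complexification \<Rightarrow> 'a complexification" and n :: nat
    assume T: "bounded_clinear T \<and> positive_operator T \<and> strongly_Kreiss_bounded T Ks" and n: "1 \<le> n"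
    show "onorm (T ^^ n) \<le> C * real n powr a * ln (real n + 2) powr (ln C / ln (5 / 4))"
      by (rule onorm_funpow_positive_operator_le) (use T n C * in auto)
  qed
  show ?thesis
  proof (intro conjI allI impI; elim conjE; rule bound)
    fix p and T :: "'a complexification \<Rightarrow> 'a complexification" and n :: nat and x :: 'a
    assume p: "2 < p" "p_convex TYPE('a) p"
      and T: "bounded_clinear T" "positive_operator T" "strongly_Kreiss_bounded T Ks"
      and n: "1 \<le> n" "0 \<le> x"
    have "0 < p" using p(1) by (rule le_less_trans[OF zero_le])
    show "norm ((real_restriction T ^^ n) x)
        \<le> C * real n powr enn2real (1 / p) * ln (real n + 2) powr (ln C / ln (5 / 4)) * norm x"
    proof (rule upper_estimate_growth[OF _ real_restriction_nonneg[OF T(2)] _ _ C _ n])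
      show "linear (real_restriction T)"
        using T(1) bounded_linear_real_restriction bounded_linear.linear by (auto simp: bounded_clinear_def)
    qed (use strongly_Kreiss_window_bound[OF T] p_convex_upper_estimate[OF p(2) \<open>0 < p\<close>] in
        \<open>auto simp: C_def\<close>)
  next
    fix q q' and T :: "'a complexification \<Rightarrow> 'a complexification" and n :: nat and x :: 'a
    assume q: "1 \<le> q" "q < 2" "1 / q + 1 / q' = 1" "q_concave TYPE('a) q"
      and T: "bounded_clinear T" "positive_operator T" "strongly_Kreiss_bounded T Ks"
      and n: "1 \<le> n" "0 \<le> x"
    have "q < \<infinity>" using q(2) by (rule less_trans) simp
    have "0 < enn2real q" using q(1) \<open>q < \<infinity>\<close> by (simp add: enn2real_positive_iff less_le_trans[OF zero_less_one])
    \<comment> \<open>The conjugacy relation lives in \<open>ennreal\<close>; both summands are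
      finite, so \<open>enn2real\<close> respects the sum. For \<open>q = 1\<close> it forces
      \<open>1 / q' = 0\<close>.\<close>
    have eq: "enn2real (1 / q') = 1 - 1 / enn2real q"
    proof -
      have "1 / q = ennreal (1 / enn2real q)"
        using \<open>0 < enn2real q\<close> \<open>q < \<infinity>\<close> divide_ennreal[of 1 "enn2real q"] by simp
      moreover have "1 / q' < \<infinity>" using q(3) by (metis ennreal_add_eq_top ennreal_one_neq_top infinity_ennreal_def less_top)
      then have "enn2real (1 / q + 1 / q') = enn2real (1 / q) + enn2real (1 / q')"
        using calculation by (intro enn2real_plus) auto
      ultimately show ?thesis using q(3) by simp
    qed
    have "real w * b \<le> real w powr enn2real (1 / q') * norm (\<Sum>m<w. f m)"
      if "0 < w" "0 \<le> b" "\<And>m. m < w \<Longrightarrow> 0 \<le> f m \<and> b \<le> norm (f m)" for w b and f :: "nat \<Rightarrow> 'a"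
      unfolding eq by (rule q_concave_lower_estimate[OF q(4,1) \<open>q < \<infinity>\<close> that])
    then show "norm ((real_restriction T ^^ n) x)
        \<le> C * real n powr enn2real (1 / q') * ln (real n + 2) powr (ln C / ln (5 / 4)) * norm x"
      using strongly_Kreiss_window_bound[OF T]
      by (intro lower_estimate_growth[OF real_restriction_nonneg[OF T(2)] _ _ C _ n]) (auto simp: C_def)
  qed
qed

end
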